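(* For every integer $n\ge 1$, $$\mathbb{P}(M_n=1)=\frac{p(n-1)}{p(n)}.$$ In addition, as $n\to\infty$, $$\mathbb{P}(M_n=1)=1-\frac{c}{\sqrt{n}}+\frac{1+c^2/2}{n}+O(n^{-3/2}),$$ where $c=\frac{\pi}{\sqrt{6}}$.
   Context: For an integer $n\ge 1$, a partition $\lambda$ of $n$ is a representation $n=\lambda_1+\lambda_2+\dots+\lambda_k$ with $k\ge 1$ and positive integers $\lambda_1\ge\lambda_2\ge\dots\ge\lambda_k$. Let $\Lambda(n)$ be the set of all partitions of $n$ and $p(n)=|\Lambda(n)|$, with $p(0)=1$. $\mathbb{P}$ denotes the uniform probability measure on $\Lambda(n)$, i.e. each $\lambda\in\Lambda(n)$ has probability $1/p(n)$. For $\lambda\in\Lambda(n)$, $M_n=M_n(\lambda)$ is the multiplicity of the largest part $\lambda_1$, i.e. the number of indices $j\in\{1,\dots,k\}$ with $\lambda_j=\lambda_1$. *)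

theory Defs
  imports "HOL-Probability.Probability" "HOL-Library.Landau_Symbols"
begin

(* A partition is the list of its parts in weakly decreasing order.  For n \<ge> 1 the list is
   automatically nonempty; for n = 0 only the empty list qualifies, which gives p(0) = 1. *)
definition number_partitions :: "nat \<Rightarrow> nat list set" where
  "number_partitions n =
     {xs. sorted_wrt (\<ge>) xs \<and> (\<forall>x\<in>set xs. 0 < x) \<and> sum_list xs = n}"

definition partition_count :: "nat \<Rightarrow> nat" where
  "partition_count n = card (number_partitions n)"

(* Meaningful for nonempty lists only: for a partition of n \<ge> 1, hd xs is the largest part. *)
definition largest_part_mult :: "nat list \<Rightarrow> nat" where
  "largest_part_mult xs = count_list xs (hd xs)"

(* The two facts below ensure that pmf_of_set (number_partitions n) really is the uniform
   distribution. *)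
lemma finite_number_partitions: "finite (number_partitions n)"
proof (rule finite_subset)
  have len: "length xs \<le> sum_list xs" if "\<forall>x\<in>set xs. 0 < x" for xs :: "nat list"
    using that by (induction xs) auto
  show "number_partitions n \<subseteq> {xs. set xs \<subseteq> {..n} \<and> length xs \<le> n}"
    using len member_le_sum_list by (auto simp: number_partitions_def)
  show "finite {xs. set xs \<subseteq> {..n} \<and> length xs \<le> n}"
    by (rule finite_lists_length_le) simp
qed

lemma number_partitions_nonempty: "number_partitions n \<noteq> {}"
proof -
  have "replicate n 1 \<in> number_partitions n"
    by (simp add: number_partitions_def sorted_wrt_iff_nth_less sum_list_replicate)
  then show ?thesis by blast
qed

lemma number_partitions_0: "number_partitions 0 = {[]}"
proof -
  have "xs = []" if "xs \<in> number_partitions 0" for xs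
    using that by (cases xs) (auto simp: number_partitions_def)
  moreover have "[] \<in> number_partitions 0" by (simp add: number_partitions_def)
  ultimately show ?thesis by blast
qed

lemma partition_count_0: "partition_count 0 = 1"
  by (simp add: partition_count_def number_partitions_0)

definition prob_largest_part_unique :: "nat \<Rightarrow> real" where
  "prob_largest_part_unique n =
     measure_pmf.prob (pmf_of_set (number_partitions n)) {xs. largest_part_mult xs = 1}"

end

theory Submission
  imports Defs "HOL-Complex_Analysis.Complex_Analysis" "HOL-Real_Asymp.Real_Asymp"
begin

text \<open>
  Let \<open>p n\<close> be the number of partitions of \<open>n\<close>, \<open>c = pi / sqrt 6\<close> and, for \<open>Re z > 0\<close>,
  \<open>P z = (\<Sum>n. p n * exp (- n * z))\<close>.

  Lowering a largest part that occurs only once by one is a bijection from the partitions of \<open>n\<close>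
  with \<open>M n = 1\<close> onto all partitions of \<open>n - 1\<close> (\<open>card_unique_largest\<close>); this is the exact
  formula.  The expansion is therefore a statement about \<open>p (n - 1) / p n\<close>, and it is obtained by
  the circle method.  By Cauchy's formula on the line \<open>Re z = a\<close>, with \<open>a = c / sqrt n\<close>,
  \<open>1 - p (n - 1) / p n\<close> is the mean of \<open>1 - exp (- z)\<close> with respect to the complex weight
  \<open>P z * exp (n * z)\<close> on the segment \<open>\<bar>Im z\<bar> \<le> pi\<close>
  (\<open>partition_count_has_integral\<close>).

  Write \<open>P = exp Q\<close> with \<open>Q z = (\<Sum>m\<ge>1. 1 / (m * (exp (m * z) - 1)))\<close> (\<open>partition_gf\<close>).  In the
  sector \<open>\<bar>Im z\<bar> \<le> Re z\<close> a first-order comparison of the sum \<open>Q'\<close> with an integral gives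
  \<open>Q' z = - c^2 / z^2 + 1 / (2 * z) + O(1)\<close> (\<open>deriv_log_gf_approx\<close>), so
  \<open>P z = sqrt z * exp (c^2 / z) * exp (H z)\<close> with \<open>H\<close> Lipschitz near \<open>0\<close>
  (\<open>gf_correction_lipschitz\<close>).  This is precise enough: relative to its value at \<open>z = a\<close> the
  factor \<open>exp (H z)\<close> contributes an error \<open>O(\<bar>z - a\<bar>)\<close>, and it is multiplied by the deviation
  of \<open>1 - exp (- z)\<close> from its mean, essentially another \<open>O(\<bar>z - a\<bar>)\<close>, while \<open>\<bar>z - a\<bar>^2\<close> is of order \<open>n powr (- 3/2)\<close> on average.
  Outside the sector the first term of the series \<open>Q\<close> alone makes \<open>P\<close> exponentially smaller
  (\<open>log_gf_minor_bound\<close>).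

  There remain the explicit integrals of \<open>\<zeta> powr s * exp (X * (\<zeta> + 1 / \<zeta>))\<close> over the segment
  from \<open>1 - \<i>\<close> to \<open>1 + \<i>\<close>, where \<open>z = a * \<zeta>\<close> and \<open>X = c * sqrt n\<close>.  Only half-integral \<open>s\<close> occur,
  so up to exponentially small boundary terms the integrals for \<open>s = -3/2, -1/2, 1/2, 3/2\<close> are
  linked by two integrations by parts and by the substitutions
  \<open>sqrt \<zeta> + 1 / sqrt \<zeta>\<close> and \<open>sqrt \<zeta> - 1 / sqrt \<zeta>\<close>, which turn the exponential into a Gaussian.
  This yields the exact order of magnitude of the denominator (\<open>saddle_integral_lower\<close>) and the
  mean of \<open>\<zeta> - 1\<close>, which is \<open>- 1 / X + O(1 / X^2)\<close> (\<open>saddle_integral_drift\<close>).  Hence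
  \<open>p (n - 1) / p n = exp (- a) * (1 + 1 / n) + O(n powr (- 3/2))\<close>, and expanding the exponential
  finishes the proof.
\<close>

section \<open>Partitions whose largest part is unique\<close>

lemma card_unique_largest:
  assumes "n \<ge> 1"
  shows "card {xs \<in> number_partitions n. largest_part_mult xs = 1} = partition_count (n - 1)"
proof -
  define g :: "nat list \<Rightarrow> nat list"
    where "g ys = (case ys of [] \<Rightarrow> [1] | y # ys' \<Rightarrow> Suc y # ys')" for ys
  \<comment> \<open>\<open>g\<close> increases a largest part by one; the empty partition, which occurs for \<open>n = 1\<close>,
    goes to the partition of \<open>1\<close>.\<close>
  have "bij_betw g (number_partitions (n - 1)) {xs \<in> number_partitions n. largest_part_mult xs = 1}"
  proof (rule bij_betwI')
    fix xs ys assume "xs \<in> number_partitions (n-1)" "ys \<in> number_partitions (n-1)"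
    then show "(g xs = g ys) = (xs = ys)"
      by (auto simp: g_def number_partitions_def split: list.splits)
  next
    fix ys assume ys: "ys \<in> number_partitions (n-1)"
    show "g ys \<in> {xs \<in> number_partitions n. largest_part_mult xs = 1}"
    proof (cases ys)
      case Nil
      then show ?thesis using ys assms
        by (auto simp: number_partitions_def g_def largest_part_mult_def)
    next
      case (Cons y zs)
      then have "Suc y \<notin> set zs" using ys by (auto simp: number_partitions_def)
      then have "count_list zs (Suc y) = 0" by (simp add: count_list_0_iff)
      then show ?thesis using Cons ys assms
        by (auto simp: number_partitions_def g_def largest_part_mult_def intro: le_SucI)
    qed
  next
    fix xs assume xs: "xs \<in> {xs \<in> number_partitions n. largest_part_mult xs = 1}"
    then obtain x zs where c: "xs = x # zs" using assms
      by (cases xs) (auto simp: number_partitions_def)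
    then have x: "x \<notin> set zs" using xs
      by (auto simp: largest_part_mult_def count_list_0_iff split: if_splits)
    show "\<exists>ys\<in>number_partitions (n - 1). xs = g ys"
    proof (cases "x = 1")
      case True
      have "zs = []" using x xs unfolding c True
        by (cases zs) (auto simp: number_partitions_def)
      then show ?thesis using True c xs
        by (intro bexI[of _ "[]"]) (auto simp: number_partitions_def g_def)
    next
      case False
      then have "x \<ge> 2" using xs c by (cases x) (auto simp: number_partitions_def)
      moreover have "\<forall>z\<in>set zs. z < x"
      proof
        fix z assume z: "z \<in> set zs"
        then have "z \<le> x" using xs c by (auto simp: number_partitions_def)
        with z x show "z < x" by (metis le_neq_implies_less)
      qed
      ultimately show ?thesis using c xs
        by (intro bexI[of _ "(x - 1) # zs"]) (force simp: number_partitions_def g_def)+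
    qed
  qed
  then show ?thesis unfolding partition_count_def by (simp add: bij_betw_same_card)
qed

lemma prob_largest_part_unique_eq:
  assumes "n \<ge> 1"
  shows "prob_largest_part_unique n = real (partition_count (n - 1)) / real (partition_count n)"
proof -
  have "number_partitions n \<inter> {xs. largest_part_mult xs = 1}
      = {xs \<in> number_partitions n. largest_part_mult xs = 1}" by auto
  then show ?thesis
    using card_unique_largest[OF assms] unfolding prob_largest_part_unique_def
    by (simp add: measure_pmf_of_set number_partitions_nonempty finite_number_partitions
        partition_count_def)
qed

text \<open>
  The number of partitions of \<open>n\<close> all of whose parts are at most \<open>k\<close>.
\<close>
definition bounded_partition_count :: "nat \<Rightarrow> nat \<Rightarrow> nat" where
  "bounded_partition_count k n = card {xs \<in> number_partitions n. \<forall>x\<in>set xs. x \<le> k}"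

lemma bounded_partition_count_le: "bounded_partition_count k n \<le> partition_count n"
  unfolding bounded_partition_count_def partition_count_def
  by (rule card_mono) (auto simp: finite_number_partitions)

lemma bounded_partition_count_eq:
  assumes "n \<le> k"
  shows "bounded_partition_count k n = partition_count n"
proof -
  have "x \<le> k" if "xs \<in> number_partitions n" "x \<in> set xs" for x xs
    using that assms member_le_sum_list[of x xs] by (simp add: number_partitions_def)
  then have "{xs \<in> number_partitions n. \<forall>x\<in>set xs. x \<le> k} = number_partitions n"
    by blast
  then show ?thesis by (simp add: bounded_partition_count_def partition_count_def)
qed

lemma bounded_partition_count_0: "bounded_partition_count 0 n = (if n = 0 then 1 else 0)"
proof -
  have "xs \<in> number_partitions n \<and> (\<forall>x\<in>set xs. x \<le> 0) \<longleftrightarrow> n = 0 \<and> xs = []" for xs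
    by (cases xs) (auto simp: number_partitions_def)
  then show ?thesis by (simp add: bounded_partition_count_def)
qed

text \<open>
  A partition with parts at most \<open>k + 1\<close> has all parts at most \<open>k\<close>, or its first part is \<open>k + 1\<close>
  and can be split off.
\<close>
lemma bounded_partition_count_Suc:
  "bounded_partition_count (Suc k) n = bounded_partition_count k n +
     (if Suc k \<le> n then bounded_partition_count (Suc k) (n - Suc k) else 0)"
proof -
  define A where "A = {xs \<in> number_partitions n. \<forall>x\<in>set xs. x \<le> Suc k}"
  define B where "B = {xs \<in> number_partitions n. \<forall>x\<in>set xs. x \<le> k}"
  define D where "D = (if Suc k \<le> n then (#) (Suc k) ` 
       {xs \<in> number_partitions (n - Suc k). \<forall>x\<in>set xs. x \<le> Suc k} else {})"
  have "A = B \<union> D"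
  proof (intro set_eqI iffI)
    fix xs assume xs: "xs \<in> A"
    show "xs \<in> B \<union> D"
    proof (cases "Suc k \<in> set xs")
      case False
      then show ?thesis using xs by (auto simp: A_def B_def le_Suc_eq)
    next
      case True
      then obtain x ys where c: "xs = x # ys" by (cases xs) auto
      then have "x = Suc k" using xs True by (auto simp: A_def number_partitions_def)
      then show ?thesis using c xs by (auto simp: A_def D_def number_partitions_def)
    qed
  next
    fix xs assume "xs \<in> B \<union> D"
    then show "xs \<in> A"
      by (auto simp: A_def B_def D_def number_partitions_def le_Suc_eq split: if_splits)
  qed
  moreover have "B \<inter> D = {}" by (auto simp: B_def D_def)
  moreover have "finite B" "finite D" by (auto simp: B_def D_def finite_number_partitions)
  ultimately have "card A = card B + card D" by (simp add: card_Un_disjoint)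
  moreover have "card D = (if Suc k \<le> n then bounded_partition_count (Suc k) (n - Suc k) else 0)"
    by (auto simp: D_def bounded_partition_count_def card_image)
  ultimately show ?thesis by (simp add: A_def B_def bounded_partition_count_def)
qed

section \<open>The generating function and its logarithm\<close>

text \<open>
  The series \<open>Q\<close> whose exponential is the partition generating function at \<open>exp (- z)\<close>: it is the
  sum of \<open>- Ln (1 - exp (- j * z))\<close> over \<open>j \<ge> 1\<close>, with each logarithm expanded and the sum over \<open>j\<close>
  carried out first.  It is meaningful for \<open>Re z > 0\<close>.
\<close>
definition log_gf :: "complex \<Rightarrow> complex" where
  "log_gf z = (\<Sum>m. 1 / (of_nat (Suc m) * (exp (of_nat (Suc m) * z) - 1)))"

lemma norm_exp_minus_one_ge: "Re w \<le> cmod (exp w - 1)"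
proof -
  have "1 + Re w \<le> cmod (exp w)" by simp
  also have "\<dots> \<le> cmod 1 + cmod (exp w - 1)" by (rule norm_triangle_sub)
  finally show ?thesis by simp
qed

lemma exp_neq_one: "Re w > 0 \<Longrightarrow> exp w \<noteq> 1"
  using norm_exp_minus_one_ge[of w] by auto

lemma summable_inverse_Suc_squared: "summable (\<lambda>m. 1 / real (Suc m)^2)"
  using inverse_squares_sums by (simp add: sums_iff add.commute)

lemma norm_log_gf_term_le:
  assumes "Re z > 0"
  shows "cmod (1 / (of_nat (Suc m) * (exp (of_nat (Suc m) * z) - 1))) \<le> 1 / Re z * (1 / real (Suc m)^2)"
proof -
  have "real (Suc m) * Re z \<le> cmod (exp (of_nat (Suc m) * z) - 1)"
    using norm_exp_minus_one_ge[of "of_nat (Suc m) * z"] by simp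
  then have "real (Suc m) * (real (Suc m) * Re z)
       \<le> real (Suc m) * cmod (exp (of_nat (Suc m) * z) - 1)"
    by (intro mult_left_mono) auto
  then have "1 / (real (Suc m) * cmod (exp (of_nat (Suc m) * z) - 1))
       \<le> 1 / (real (Suc m) * (real (Suc m) * Re z))"
    using assms by (intro divide_left_mono) (auto intro!: mult_pos_pos exp_neq_one simp del: of_nat_Suc)
  then show ?thesis by (simp add: norm_divide norm_mult power2_eq_square mult_ac del: of_nat_Suc)
qed

lemma log_gf_sums:
  assumes "Re z > 0"
  shows "(\<lambda>m. 1 / (of_nat (Suc m) * (exp (of_nat (Suc m) * z) - 1))) sums log_gf z"
proof -
  have "summable (\<lambda>m. 1 / (of_nat (Suc m) * (exp (of_nat (Suc m) * z) - 1)) :: complex)"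
    by (rule summable_comparison_test'[OF summable_mult[OF summable_inverse_Suc_squared]])
      (rule norm_log_gf_term_le[OF assms])
  then show ?thesis unfolding log_gf_def by (rule summable_sums)
qed

lemma log_gf_derivative:
  assumes "Re z > 0"
  shows "(\<lambda>m. - exp (of_nat (Suc m) * z) / (exp (of_nat (Suc m) * z) - 1)\<^sup>2) sums deriv log_gf z"
    and "(log_gf has_field_derivative deriv log_gf z) (at z)"
proof -
  define S where "S = {z. Re z > 0}"
  define f where "f = (\<lambda>m z. 1 / (of_nat (Suc m) * (exp (of_nat (Suc m) * z) - 1)) :: complex)"
  define f' where "f' = (\<lambda>m z. - exp (of_nat (Suc m) * z) / (exp (of_nat (Suc m) * z) - 1)\<^sup>2 :: complex)"
  have op: "open S" unfolding S_def by (rule open_halfspace_Re_gt)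
  have "\<exists>g g'. \<forall>x\<in>S. ((\<lambda>m. f m x) sums g x) \<and> ((\<lambda>m. f' m x) sums g' x) \<and>
          (g has_field_derivative g' x) (at x)"
  proof (rule series_and_derivative_comparison_complex[OF op])
    fix m x assume "x \<in> S"
    then have nz: "exp (of_nat (Suc m) * x) \<noteq> 1"
      by (auto intro!: exp_neq_one simp: S_def simp del: of_nat_Suc)
    have "((\<lambda>z. 1 / (d * (exp (d * z) - 1))) has_field_derivative
        - exp (d * x) / (exp (d * x) - 1)\<^sup>2) (at x)" if "d \<noteq> 0" "exp (d * x) \<noteq> 1" for d :: complex
      by (rule derivative_eq_intros refl | use that in force)+
        (use that in \<open>simp add: divide_simps power2_eq_square\<close>)
    from this[OF _ nz] show "(f m has_field_derivative f' m x) (at x)"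
      unfolding f_def f'_def by (simp del: of_nat_Suc)
  next
    fix x assume x: "x \<in> S"
    define h where "h = (\<lambda>m. of_real (2 / Re x * (1 / real (Suc m)^2)) :: complex)"
    have "cmod (f m y) \<le> cmod (h m)" if "y \<in> ball x (Re x / 2) \<inter> S" for m y
    proof -
      have y: "Re y > 0" "cmod (x - y) < Re x / 2" using that by (auto simp: S_def dist_norm)
      have "Re x - Re y \<le> cmod (x - y)" using abs_Re_le_cmod[of "x - y"] by simp
      then have "Re x / 2 \<le> Re y" using y by linarith
      have "cmod (f m y) \<le> 1 / Re y * (1 / real (Suc m)^2)"
        unfolding f_def by (rule norm_log_gf_term_le[OF y(1)])
      also have "\<dots> \<le> 2 / Re x * (1 / real (Suc m)^2)"
        using \<open>Re x / 2 \<le> Re y\<close> x by (intro mult_right_mono) (auto simp: S_def field_simps)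
      also have "\<dots> = cmod (h m)" using x unfolding h_def norm_of_real by (simp add: S_def)
      finally show ?thesis .
    qed
    moreover have "summable h" unfolding h_def
      by (intro summable_of_real summable_mult summable_inverse_Suc_squared)
    moreover have "range h \<subseteq> \<real>\<^sub>\<ge>\<^sub>0" using x
      unfolding h_def by (auto simp: S_def simp del: of_real_mult of_real_divide)
    ultimately show "\<exists>d h. 0 < d \<and> summable h \<and> range h \<subseteq> \<real>\<^sub>\<ge>\<^sub>0 \<and>
        (\<forall>\<^sub>F m in sequentially. \<forall>y\<in>ball x d \<inter> S. cmod (f m y) \<le> cmod (h m))"
      using x by (intro exI[of _ "Re x / 2"] exI[of _ h]) (auto simp: S_def intro!: always_eventually)
  qed
  then obtain g g' where g: "\<And>x. x \<in> S \<Longrightarrow> (\<lambda>m. f m x) sums g x"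
    "\<And>x. x \<in> S \<Longrightarrow> (\<lambda>m. f' m x) sums g' x" "\<And>x. x \<in> S \<Longrightarrow> (g has_field_derivative g' x) (at x)"
    by blast
  have gl: "g x = log_gf x" if "x \<in> S" for x
    using g(1)[OF that] by (simp add: log_gf_def f_def sums_iff)
  have z: "z \<in> S" using assms by (simp add: S_def)
  have "(log_gf has_field_derivative g' z) (at z)"
    using has_field_derivative_transform_within_open[OF g(3)[OF z] op z gl] .
  moreover from this have "deriv log_gf z = g' z" by (rule DERIV_imp_deriv)
  ultimately show "(log_gf has_field_derivative deriv log_gf z) (at z)"
    "(\<lambda>m. - exp (of_nat (Suc m) * z) / (exp (of_nat (Suc m) * z) - 1)\<^sup>2) sums deriv log_gf z"
    using g(2)[OF z] by (simp_all add: f'_def)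
qed

text \<open>
  The recurrence reads \<open>f = g + q ^ (k + 1) * f\<close> for the generating functions \<open>f\<close> and \<open>g\<close> of
  the partitions with parts at most \<open>k + 1\<close> and at most \<open>k\<close>.
\<close>
lemma bounded_partition_gf:
  assumes "cmod q < 1"
  shows "summable (\<lambda>n. real (bounded_partition_count k n) * cmod q ^ n) \<and>
         (\<lambda>n. of_nat (bounded_partition_count k n) * q ^ n) sums (\<Prod>j<k. 1 / (1 - q ^ Suc j))"
proof (induction k)
  case 0
  have "(\<lambda>n. of_nat (bounded_partition_count 0 n) * q ^ n) = (\<lambda>n. if n = 0 then 1 else 0)"
    "(\<lambda>n. real (bounded_partition_count 0 n) * cmod q ^ n) = (\<lambda>n. if n = 0 then 1 else 0)"
    by (auto simp: bounded_partition_count_0)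
  then show ?case using sums_single[of 0 "\<lambda>_. 1::complex"] sums_single[of 0 "\<lambda>_. 1::real"]
    by (auto simp: sums_iff)
next
  case (Suc k)
  define x where "x = cmod q"
  have x: "0 \<le> x" "x < 1" using assms by (auto simp: x_def)
  let ?f = "bounded_partition_count (Suc k)" and ?g = "bounded_partition_count k"
  have xk: "x ^ Suc k < 1" using x by (metis power_Suc_less_one less_eq_real_def power_0_Suc)
  \<comment> \<open>The recurrence, applied to partial sums \<open>s\<close>, gives \<open>s \<le> G + x ^ (k + 1) * s\<close>, which bounds
    them.\<close>
  have sf: "summable (\<lambda>n. real (?f n) * x ^ n)"
  proof (rule bounded_imp_summable)
    fix N
    define s where "s = (\<Sum>n\<le>N. real (?f n) * x ^ n)"
    have "s = (\<Sum>n\<le>N. real (?g n) * x ^ n)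
         + (\<Sum>n\<le>N. if Suc k \<le> n then real (?f (n - Suc k)) * x ^ n else 0)"
      unfolding s_def sum.distrib[symmetric]
      by (intro sum.cong refl, subst bounded_partition_count_Suc) (auto simp: algebra_simps)
    also have "(\<Sum>n\<le>N. if Suc k \<le> n then real (?f (n - Suc k)) * x ^ n else 0)
        = (\<Sum>n\<in>{n\<in>{..N}. Suc k \<le> n}. real (?f (n - Suc k)) * x ^ n)"
      by (subst sum.inter_filter) auto
    also have "\<dots> \<le> (\<Sum>n\<le>N. x ^ Suc k * (real (?f n) * x ^ n))"
    proof (rule sum_le_included)
      show "\<forall>n\<in>{n\<in>{..N}. Suc k \<le> n}. \<exists>m\<in>{..N}. m + Suc k = n \<and>
         real (?f (n - Suc k)) * x ^ n \<le> x ^ Suc k * (real (?f m) * x ^ m)"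
      proof
        fix n assume "n \<in> {n\<in>{..N}. Suc k \<le> n}"
        then show "\<exists>m\<in>{..N}. m + Suc k = n \<and>
         real (?f (n - Suc k)) * x ^ n \<le> x ^ Suc k * (real (?f m) * x ^ m)"
          using power_add[of x "Suc k" "n - Suc k"]
          by (intro bexI[of _ "n - Suc k"]) (auto simp: mult_ac)
      qed
    qed (use x in auto)
    also have "\<dots> = x ^ Suc k * s" by (simp add: s_def sum_distrib_left)
    also have "(\<Sum>n\<le>N. real (?g n) * x ^ n) \<le> (\<Sum>n. real (?g n) * x ^ n)"
      using Suc x by (intro sum_le_suminf) (auto simp: x_def)
    finally have "s * (1 - x ^ Suc k) \<le> (\<Sum>n. real (?g n) * x ^ n)" by (simp add: algebra_simps)
    then show "(\<Sum>n\<le>N. real (?f n) * x ^ n) \<le> (\<Sum>n. real (?g n) * x ^ n) / (1 - x ^ Suc k)"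
      using xk by (simp add: s_def field_simps)
  qed (use x in auto)
  then have "summable (\<lambda>n. norm (of_nat (?f n) * q ^ n))"
    by (simp add: norm_mult norm_power x_def)
  then have "summable (\<lambda>n. of_nat (?f n) * q ^ n)" by (rule summable_norm_cancel)
  then obtain F where F: "(\<lambda>n. of_nat (?f n) * q ^ n) sums F" by (auto simp: summable_def)
  define h where "h n = (if Suc k \<le> n then of_nat (?f (n - Suc k)) * q ^ n else 0)" for n
  have "(\<lambda>n. h (n + Suc k)) sums (q ^ Suc k * F)"
    using sums_mult[OF F, of "q ^ Suc k"] by (simp add: h_def power_add mult_ac)
  then have "h sums (q ^ Suc k * F)"
    by (subst (asm) sums_zero_iff_shift) (auto simp: h_def)
  then have "(\<lambda>n. of_nat (?g n) * q ^ n + h n) sums ((\<Prod>j<k. 1 / (1 - q ^ Suc j)) + q ^ Suc k * F)"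
    using Suc by (intro sums_add) auto
  also have "(\<lambda>n. of_nat (?g n) * q ^ n + h n) = (\<lambda>n. of_nat (?f n) * q ^ n)"
  proof
    fix n
    show "of_nat (?g n) * q ^ n + h n = of_nat (?f n) * q ^ n"
      using bounded_partition_count_Suc[of k n] by (auto simp: h_def algebra_simps)
  qed
  finally have eq: "F = (\<Prod>j<k. 1 / (1 - q ^ Suc j)) + q ^ Suc k * F"
    using F sums_unique2 by blast
  have "q ^ Suc k \<noteq> 1"
    using xk unfolding x_def by (metis norm_one norm_power less_irrefl)
  then have "F = (\<Prod>j<Suc k. 1 / (1 - q ^ Suc j))"
    using eq by (simp add: field_simps)
  then show ?case using F sf by (simp add: x_def)
qed

lemma minus_Ln_one_minus_sums:
  assumes "cmod w < 1"
  shows "(\<lambda>m. w ^ Suc m / of_nat (Suc m)) sums (- Ln (1 - w))"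
proof -
  have "(\<lambda>n. - (w ^ n) / of_nat n) sums Ln (1 - w)"
    using Ln_series'[of "-w"] assms by simp
  then have "(\<lambda>n. w ^ n / of_nat n) sums - Ln (1 - w)"
    using sums_minus by fastforce
  then show ?thesis by (subst sums_Suc_iff) simp
qed

text \<open>
  The double series for the logarithm of the finite product is summed over \<open>j\<close> first; Tannery's
  theorem allows \<open>k\<close> to tend to infinity inside the sum over \<open>m\<close>.
\<close>
lemma euler_product_tendsto:
  assumes "Re z > 0"
  shows "(\<lambda>k. \<Prod>j<k. 1 / (1 - exp (-z) ^ Suc j)) \<longlonglongrightarrow> exp (log_gf z)"
proof -
  define q where "q = exp (-z)"
  define r where "r = cmod q"
  have r: "r = exp (- Re z)" by (simp add: r_def q_def)
  have r01: "0 < r" "r < 1" using assms by (auto simp: r)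
  have pw: "r ^ Suc j < 1" for j
    using r01 by (metis power_less_one_iff zero_less_Suc less_imp_le)
  define a where "a m k = (\<Sum>j<k. (q ^ Suc j) ^ Suc m / of_nat (Suc m))" for m k
  define b where "b m = 1 / (of_nat (Suc m) * (exp (of_nat (Suc m) * z) - 1))" for m
  have prod: "(\<Prod>j<k. 1 / (1 - q ^ Suc j)) = exp (\<Sum>m. a m k)" for k
  proof -
    have c: "cmod (q ^ Suc j) < 1" for j
      using pw[of j] by (simp add: norm_mult norm_power r_def)
    have nz: "1 - q ^ Suc j \<noteq> 0" for j using c[of j] by (metis norm_one less_irrefl eq_iff_diff_eq_0)
    have "(\<lambda>m. a m k) sums (\<Sum>j<k. - Ln (1 - q ^ Suc j))"
      unfolding a_def by (intro sums_sum minus_Ln_one_minus_sums c)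
    then have "exp (\<Sum>m. a m k) = (\<Prod>j<k. exp (- Ln (1 - q ^ Suc j)))"
      by (simp add: sums_iff exp_sum)
    also have "\<dots> = (\<Prod>j<k. 1 / (1 - q ^ Suc j))"
      using nz by (intro prod.cong refl) (simp add: exp_minus inverse_eq_divide del: power_Suc)
    finally show ?thesis by simp
  qed
  have geo: "(\<lambda>j. (p ^ Suc j) ^ Suc m / of_nat (Suc m)) sums (1 / of_nat (Suc m) * (p ^ Suc m / (1 - p ^ Suc m)))"
    if "cmod p < 1" for p m
  proof -
    have "cmod (p ^ Suc m) < 1" using that
      by (metis norm_power norm_ge_zero power_less_one_iff zero_less_Suc)
    then have "(\<lambda>j. (p ^ Suc m / of_nat (Suc m)) * (p ^ Suc m) ^ j) sums ((p ^ Suc m / of_nat (Suc m)) * (1 / (1 - p ^ Suc m)))"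
      by (intro sums_mult geometric_sums)
    also have "(\<lambda>j. (p ^ Suc m / of_nat (Suc m)) * (p ^ Suc m) ^ j) = (\<lambda>j. (p ^ Suc j) ^ Suc m / of_nat (Suc m))"
      by (simp only: power_mult[symmetric] power_add[symmetric] mult.commute times_divide_eq_right times_divide_eq_left)
        (simp add: power_add[symmetric] algebra_simps)
    finally show ?thesis by (simp add: mult_ac)
  qed
  have lim: "(\<lambda>k. a m k) \<longlonglongrightarrow> b m" for m
  proof -
    have "1 / of_nat (Suc m) * (q ^ Suc m / (1 - q ^ Suc m)) = b m"
    proof -
      have "q ^ Suc m = inverse (exp (of_nat (Suc m) * z))"
        unfolding q_def exp_of_nat_mult[symmetric] by (simp add: exp_minus[symmetric] del: of_nat_Suc)
      moreover have "exp (of_nat (Suc m) * z) \<noteq> 1" using assms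
        by (intro exp_neq_one) (simp del: of_nat_Suc)
      moreover have "1 / d * (inverse w / (1 - inverse w)) = 1 / (d * (w - 1))"
        if "w \<noteq> 0" "w \<noteq> 1" for d w :: complex
        using that by (simp add: divide_simps)
      ultimately show ?thesis unfolding b_def by (simp only: exp_not_eq_zero not_False_eq_True)
    qed
    then show ?thesis using geo[of q m] r01 by (simp add: sums_def a_def r_def del: of_nat_Suc power_Suc)
  qed
  have bound: "cmod (a m k) \<le> 1 / Re z * (1 / real (Suc m)^2)" for m k
  proof -
    have "cmod (a m k) \<le> (\<Sum>j<k. (r ^ Suc j) ^ Suc m / real (Suc m))"
      unfolding a_def by (rule order_trans[OF norm_sum])
        (simp add: r_def norm_divide norm_mult norm_power del: of_nat_Suc)
    also have "\<dots> \<le> 1 / real (Suc m) * (r ^ Suc m / (1 - r ^ Suc m))"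
    proof -
      have "(\<lambda>j. complex_of_real ((r ^ Suc j) ^ Suc m / real (Suc m))) sums
         complex_of_real (1 / real (Suc m) * (r ^ Suc m / (1 - r ^ Suc m)))"
        using geo[of "of_real r" m] r01 by simp
      then have s: "(\<lambda>j. (r ^ Suc j) ^ Suc m / real (Suc m)) sums (1 / real (Suc m) * (r ^ Suc m / (1 - r ^ Suc m)))"
        by (simp only: sums_of_real_iff)
      show ?thesis unfolding sums_unique[OF s]
        using s r01 by (intro sum_le_suminf) (auto simp: sums_iff)
    qed
    also have "\<dots> = 1 / (real (Suc m) * (exp (real (Suc m) * Re z) - 1))"
    proof -
      have "r ^ Suc m = inverse (exp (real (Suc m) * Re z))"
        unfolding r exp_of_nat_mult[symmetric] by (simp add: exp_minus[symmetric] del: of_nat_Suc)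
      moreover have "exp (real (Suc m) * Re z) \<noteq> 1" using assms by simp
      moreover have "1 / d * (inverse w / (1 - inverse w)) = 1 / (d * (w - 1))"
        if "w \<noteq> 0" "w \<noteq> 1" for d w :: real
        using that by (simp add: divide_simps)
      ultimately show ?thesis by (simp only: exp_not_eq_zero not_False_eq_True)
    qed
    also have "\<dots> \<le> 1 / (real (Suc m) * (real (Suc m) * Re z))"
    proof -
      have "real (Suc m) * Re z \<le> exp (real (Suc m) * Re z) - 1"
        using exp_ge_add_one_self[of "real (Suc m) * Re z"] by linarith
      moreover have "0 < real (Suc m) * Re z" using assms by simp
      ultimately show ?thesis
        using assms by (intro divide_left_mono mult_left_mono mult_pos_pos) linarith+
    qed
    finally show ?thesis by (simp add: power2_eq_square mult_ac)
  qed
  have "\<forall>\<^sub>F (m, k) in sequentially \<times>\<^sub>F sequentially.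
      norm (a m k) \<le> 1 / Re z * (1 / real (Suc m)^2)"
    using bound by (intro always_eventually) (auto simp del: of_nat_Suc)
  from tannerys_theorem[OF lim this summable_mult[OF summable_inverse_Suc_squared] sequentially_bot]
  have "(\<lambda>k. \<Sum>m. a m k) \<longlonglongrightarrow> (\<Sum>m. b m)" by blast
  then have "(\<lambda>k. exp (\<Sum>m. a m k)) \<longlonglongrightarrow> exp (\<Sum>m. b m)" by (rule tendsto_exp)
  then show ?thesis by (simp add: prod[symmetric] q_def[symmetric] b_def log_gf_def)
qed

text \<open>
  Partitions with parts at most \<open>k\<close> exhaust all partitions of \<open>n\<close> once \<open>k \<ge> n\<close>, so the finite
  products converge to the full generating function, again by Tannery's theorem.
\<close>
lemma partition_gf:
  assumes "Re z > 0"
  shows "summable (\<lambda>n. real (partition_count n) * cmod (exp (-z)) ^ n)"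
    and "(\<lambda>n. of_nat (partition_count n) * exp (-z) ^ n) sums exp (log_gf z)"
proof -
  define x where "x = cmod (exp (-z))"
  have x: "0 < x" "x < 1" using assms by (auto simp: x_def)
  have xe: "exp (- complex_of_real (Re z)) = of_real x" by (simp add: x_def exp_of_real[symmetric])
  \<comment> \<open>The products at the real point \<open>x\<close> bound all partial sums of the series.\<close>
  have "Bseq (\<lambda>k. \<Prod>j<k. 1 / (1 - complex_of_real x ^ Suc j))"
    using euler_product_tendsto[of "of_real (Re z)"] assms unfolding xe
    by (intro convergent_imp_Bseq) (auto simp: convergent_def)
  then obtain K where K: "\<And>k. cmod (\<Prod>j<k. 1 / (1 - complex_of_real x ^ Suc j)) \<le> K"
    by (auto simp: Bseq_def)
  show s: "summable (\<lambda>n. real (partition_count n) * cmod (exp (-z)) ^ n)"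
  proof (rule bounded_imp_summable)
    fix N
    define g where "g = (\<lambda>n. real (bounded_partition_count N n) * x ^ n)"
    have "(\<lambda>n. complex_of_real (g n)) sums (\<Prod>j<N. 1 / (1 - complex_of_real x ^ Suc j))"
      using bounded_partition_gf[of "of_real x" N] x by (simp add: g_def)
    moreover have sg: "summable g" using bounded_partition_gf[of "of_real x" N] x by (simp add: g_def)
    ultimately have "complex_of_real (suminf g) = (\<Prod>j<N. 1 / (1 - complex_of_real x ^ Suc j))"
      by (metis sums_unique2 summable_sums sums_of_real)
    then have "suminf g \<le> K" using K[of N] by (metis norm_of_real abs_le_D1)
    have "(\<Sum>n\<le>N. real (partition_count n) * cmod (exp (-z)) ^ n) = (\<Sum>n\<le>N. g n)"
      unfolding g_def x_def by (intro sum.cong refl) (simp add: bounded_partition_count_eq)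
    also have "\<dots> \<le> suminf g" using x sg by (intro sum_le_suminf) (auto simp: g_def)
    finally show "(\<Sum>n\<le>N. real (partition_count n) * cmod (exp (-z)) ^ n) \<le> K"
      using \<open>suminf g \<le> K\<close> by linarith
  qed auto
  have q: "cmod (exp (-z)) < 1" using x by (simp add: x_def)
  define a where "a n k = of_nat (bounded_partition_count k n) * exp (-z) ^ n" for n k
  define b where "b n = of_nat (partition_count n) * exp (-z) ^ n" for n
  have lim: "a n \<longlonglongrightarrow> b n" for n
  proof (rule tendsto_eventually)
    show "\<forall>\<^sub>F k in sequentially. a n k = b n"
      using eventually_ge_at_top[of n] by eventually_elim (simp add: a_def b_def bounded_partition_count_eq)
  qed
  have bound: "cmod (a n k) \<le> real (partition_count n) * cmod (exp (-z)) ^ n" for n k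
    unfolding a_def norm_mult norm_power norm_of_nat
    by (intro mult_right_mono) (auto simp: bounded_partition_count_le)
  have T: "summable (\<lambda>n. norm (b n)) \<and> (\<lambda>k. \<Sum>n. a n k) \<longlonglongrightarrow> (\<Sum>n. b n)"
  proof -
    have "\<forall>\<^sub>F (n, k) in sequentially \<times>\<^sub>F sequentially.
        norm (a n k) \<le> real (partition_count n) * cmod (exp (-z)) ^ n"
      using bound by (intro always_eventually) auto
    from tannerys_theorem[OF lim this s sequentially_bot] show ?thesis by blast
  qed
  have "(\<Sum>n. a n k) = (\<Prod>j<k. 1 / (1 - exp (-z) ^ Suc j))" for k
    using bounded_partition_gf[OF q, of k] by (simp add: a_def sums_iff)
  then have "(\<Sum>n. b n) = exp (log_gf z)"
    using T euler_product_tendsto[OF assms] LIMSEQ_unique by auto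
  then show "(\<lambda>n. of_nat (partition_count n) * exp (-z) ^ n) sums exp (log_gf z)"
    using T summable_norm_cancel summable_sums unfolding b_def by fastforce
qed

section \<open>The logarithmic derivative near the origin\<close>

text \<open>
  The entire function \<open>(exp w - 1) / w\<close>, with its removable singularity filled in.
\<close>
definition exp_quot :: "complex \<Rightarrow> complex" where
  "exp_quot w = (if w = 0 then 1 else (exp w - 1) / w)"

text \<open>
  The entire function \<open>(exp w - 1 - w) / w^2\<close>, with its removable singularity filled in.
\<close>
definition exp_quot2 :: "complex \<Rightarrow> complex" where
  "exp_quot2 w = (if w = 0 then 1/2 else (exp_quot w - 1) / w)"

lemma exp_quot_holomorphic: "exp_quot holomorphic_on UNIV"
proof -
  have "deriv exp (0::complex) = 1" using DERIV_imp_deriv[OF DERIV_exp[of "0::complex"]] by simp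
  moreover have "(\<lambda>w::complex. if w = 0 then deriv exp 0 else (exp w - exp 0) / (w - 0)) holomorphic_on UNIV"
    by (intro pole_lemma_open holomorphic_on_exp open_UNIV)
  moreover from \<open>deriv exp (0::complex) = 1\<close>
  have "(\<lambda>w::complex. if w = 0 then deriv exp 0 else (exp w - exp 0) / (w - 0)) = exp_quot"
    by (simp add: exp_quot_def fun_eq_iff)
  ultimately show ?thesis by simp
qed

text \<open>
  Since the derivative exists, it may be computed along the positive reals.
\<close>
lemma deriv_exp_quot_0: "deriv exp_quot 0 = 1/2"
proof -
  have "(exp_quot has_field_derivative deriv exp_quot 0) (at 0)"
    using exp_quot_holomorphic holomorphic_derivI by blast
  then have "((\<lambda>w. (exp_quot w - exp_quot 0) / (w - 0)) \<longlongrightarrow> deriv exp_quot 0) (at 0)"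
    by (simp add: has_field_derivative_iff)
  moreover have "filterlim complex_of_real (at 0) (at_right 0)"
    by (auto simp: filterlim_at eventually_at_filter intro!: tendsto_eq_intros)
  ultimately have "((\<lambda>t. (exp_quot (of_real t) - exp_quot 0) / (of_real t - 0)) \<longlongrightarrow> deriv exp_quot 0) (at_right 0)"
    by (rule filterlim_compose)
  moreover have "((\<lambda>t. (exp_quot (of_real t) - exp_quot 0) / (of_real t - 0)) \<longlongrightarrow> of_real (1/2)) (at_right 0)"
  proof (rule Lim_transform_eventually)
    have "((\<lambda>t. ((exp t - 1) / t - 1) / t :: real) \<longlongrightarrow> 1/2) (at_right 0)" by real_asymp
    then show "((\<lambda>t. complex_of_real (((exp t - 1) / t - 1) / t)) \<longlongrightarrow> of_real (1/2)) (at_right 0)"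
      by (rule tendsto_of_real)
    show "\<forall>\<^sub>F t in at_right 0. complex_of_real (((exp t - 1) / t - 1) / t)
            = (exp_quot (of_real t) - exp_quot 0) / (of_real t - 0)"
      by (auto simp: eventually_at_filter exp_quot_def exp_of_real)
  qed
  ultimately have "deriv exp_quot 0 = of_real (1/2)"
    using tendsto_unique trivial_limit_at_right_real by blast
  then show ?thesis by simp
qed

lemma exp_quot2_holomorphic: "exp_quot2 holomorphic_on UNIV"
proof -
  have "(\<lambda>w. if w = 0 then deriv exp_quot 0 else (exp_quot w - exp_quot 0) / (w - 0)) holomorphic_on UNIV"
    by (intro pole_lemma_open exp_quot_holomorphic open_UNIV)
  moreover have "(\<lambda>w. if w = 0 then deriv exp_quot 0 else (exp_quot w - exp_quot 0) / (w - 0)) = exp_quot2"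
    by (simp add: exp_quot_def[of 0] exp_quot2_def deriv_exp_quot_0 fun_eq_iff)
  ultimately show ?thesis by simp
qed

text \<open>
  The function \<open>1 / w - 1 / (exp w - 1)\<close>, written so that it is visibly holomorphic at \<open>0\<close>.  Its
  derivative is \<open>exp w / (exp w - 1)^2 - 1 / w^2\<close>: the first summand, at \<open>w = k * z\<close>, is a term of
  \<open>- Q' z\<close>, so \<open>bern\<close> is the primitive needed to compare that sum with an integral.
\<close>
definition bern :: "complex \<Rightarrow> complex" where
  "bern w = exp_quot2 w / exp_quot w"

text \<open>
  A convenient open set containing the sector below on which \<open>exp w = 1\<close> only for \<open>w = 0\<close>; any
  positive radius up to \<open>2 * pi\<close> would do.
\<close>
definition bern_dom :: "complex set" where "bern_dom = ball 0 6 \<union> {w. Re w > 0}"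

lemma open_bern_dom: "open bern_dom"
  unfolding bern_dom_def by (intro open_Un open_ball open_halfspace_Re_gt)

lemma exp_neq_one_bern_dom:
  assumes "w \<in> bern_dom" "w \<noteq> 0"
  shows "exp w \<noteq> 1"
proof
  assume "exp w = 1"
  then obtain n :: int where n: "Re w = 0" "Im w = of_int (2 * n) * pi"
    by (auto simp: exp_eq_1)
  then have "n \<noteq> 0" using assms(2) by (auto simp: complex_eq_iff)
  then have "1 \<le> \<bar>real_of_int n\<bar>" by linarith
  then have "3 * 2 \<le> pi * (2 * \<bar>real_of_int n\<bar>)"
    using pi_gt3 by (intro mult_mono) auto
  also have "\<dots> = \<bar>Im w\<bar>" using n by (simp add: abs_mult)
  also have "\<dots> \<le> cmod w" by (rule abs_Im_le_cmod)
  finally show False using assms(1) n by (auto simp: bern_dom_def)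
qed

lemma bern_holomorphic: "bern holomorphic_on bern_dom"
proof -
  have "exp_quot w \<noteq> 0" if "w \<in> bern_dom" for w
    using exp_neq_one_bern_dom[OF that] by (auto simp: exp_quot_def)
  then show ?thesis unfolding bern_def
    by (intro holomorphic_on_divide)
      (auto intro: holomorphic_on_subset[OF exp_quot_holomorphic] holomorphic_on_subset[OF exp_quot2_holomorphic])
qed

lemma bern_0: "bern 0 = 1/2"
  by (simp add: bern_def exp_quot_def exp_quot2_def)

lemma bern_eq:
  assumes "w \<in> bern_dom" "w \<noteq> 0"
  shows "bern w = 1 / w - 1 / (exp w - 1)"
proof -
  have "(E / w - 1) / w / (E / w) = 1 / w - 1 / E" if "E \<noteq> 0" for E
    using that assms(2) by (simp add: field_simps)
  from this[of "exp w - 1"] show ?thesis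
    using assms exp_neq_one_bern_dom[OF assms] by (simp add: bern_def exp_quot_def exp_quot2_def)
qed

lemma deriv_bern:
  assumes "w \<in> bern_dom" "w \<noteq> 0"
  shows "deriv bern w = exp w / (exp w - 1)\<^sup>2 - 1 / w\<^sup>2"
proof -
  have op: "open (bern_dom - {0})" using open_bern_dom by (simp add: open_delete)
  have w: "w \<in> bern_dom - {0}" using assms by simp
  have "((\<lambda>w. 1 / w - 1 / (exp w - 1)) has_field_derivative exp w / (exp w - 1)\<^sup>2 - 1 / w\<^sup>2) (at w)"
    using assms exp_neq_one_bern_dom[OF assms]
    by (auto intro!: derivative_eq_intros simp: power2_eq_square)
  then have "(bern has_field_derivative exp w / (exp w - 1)\<^sup>2 - 1 / w\<^sup>2) (at w)"
    by (rule has_field_derivative_transform_within_open[OF _ op w]) (simp add: bern_eq)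
  then show ?thesis by (rule DERIV_imp_deriv)
qed

lemma deriv2_bern:
  assumes "w \<in> bern_dom" "w \<noteq> 0"
  shows "deriv (deriv bern) w = 2 / w ^ 3 - exp w * (exp w + 1) / (exp w - 1) ^ 3"
proof -
  have op: "open (bern_dom - {0})" using open_bern_dom by (simp add: open_delete)
  have w: "w \<in> bern_dom - {0}" using assms by simp
  have "(E * F\<^sup>2 - E * (2 * F * E)) / (F\<^sup>2 * F\<^sup>2) = - E * (E + 1) / F ^ 3" if "F = E - 1" "F \<noteq> 0" for E F :: complex
  proof -
    have "E * F\<^sup>2 - E * (2 * F * E) = (- E * (E + 1)) * F"
      unfolding that(1) by (simp add: power2_eq_square algebra_simps)
    moreover have "(x * F) / (F\<^sup>2 * F\<^sup>2) = x / F ^ 3" for x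
      using that(2) by (simp add: power2_eq_square power3_eq_cube)
    ultimately show ?thesis by (simp only:)
  qed
  note e = this[of "exp w - 1" "exp w"]
  have "((\<lambda>w. exp w / (exp w - 1)\<^sup>2) has_field_derivative
      (exp w * (exp w - 1)^2 - exp w * (2 * (exp w - 1) * exp w)) / ((exp w - 1)^2 * (exp w - 1)^2)) (at w)"
    using exp_neq_one_bern_dom[OF assms] by (auto intro!: derivative_eq_intros)
  moreover have "((\<lambda>w. 1 / w\<^sup>2) has_field_derivative - 2 / w ^ 3) (at w)"
    using assms by (auto intro!: derivative_eq_intros simp: power2_eq_square power3_eq_cube divide_simps)
  ultimately have "((\<lambda>w. exp w / (exp w - 1)\<^sup>2 - 1 / w\<^sup>2) has_field_derivative
       - exp w * (exp w + 1) / (exp w - 1) ^ 3 - (- 2 / w ^ 3)) (at w)"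
    using e exp_neq_one_bern_dom[OF assms] DERIV_diff by fastforce
  then have "(deriv bern has_field_derivative - exp w * (exp w + 1) / (exp w - 1) ^ 3 - (- 2 / w ^ 3)) (at w)"
    by (rule has_field_derivative_transform_within_open[OF _ op w]) (simp add: deriv_bern)
  then show ?thesis by (simp add: DERIV_imp_deriv)
qed

text \<open>
  The closed sector of opening \<open>pi / 2\<close> about the positive real axis; it contains the part
  \<open>\<bar>Im z\<bar> \<le> a\<close> of every line \<open>Re z = a\<close> with \<open>a \<ge> 0\<close>.
\<close>
definition sector :: "complex set" where "sector = {w. \<bar>Im w\<bar> \<le> Re w}"

lemma sector_eq: "sector = {w. Im w - Re w \<le> 0} \<inter> {w. - Im w - Re w \<le> 0}"
  by (auto simp: sector_def)

lemma closed_sector: "closed sector"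
  unfolding sector_eq by (intro closed_Int closed_Collect_le continuous_intros)

lemma convex_sector: "convex sector"
proof (rule convexI)
  fix x y :: complex and u v :: real
  assume *: "x \<in> sector" "y \<in> sector" "0 \<le> u" "0 \<le> v" "u + v = 1"
  have "\<bar>u * Im x + v * Im y\<bar> \<le> u * \<bar>Im x\<bar> + v * \<bar>Im y\<bar>"
    using *(3,4) abs_triangle_ineq[of "u * Im x" "v * Im y"] by (simp add: abs_mult)
  also have "\<dots> \<le> u * Re x + v * Re y"
    using * by (intro add_mono mult_left_mono) (auto simp: sector_def)
  finally show "u *\<^sub>R x + v *\<^sub>R y \<in> sector" by (simp add: sector_def)
qed

lemma norm_le_sector:
  assumes "w \<in> sector" shows "cmod w \<le> 2 * Re w"
  using cmod_le[of w] assms by (simp add: sector_def)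

lemma sector_Re_pos:
  assumes "w \<in> sector" "w \<noteq> 0" shows "Re w > 0"
  using norm_le_sector[OF assms(1)] assms(2) by (smt (verit) zero_less_norm_iff)

lemma sector_subset: "sector \<subseteq> bern_dom"
proof
  fix w assume "w \<in> sector"
  then show "w \<in> bern_dom"
    using sector_Re_pos[of w] by (cases "w = 0") (auto simp: bern_dom_def)
qed

lemma sector_scale: "w \<in> sector \<Longrightarrow> 0 \<le> r \<Longrightarrow> of_real r * w \<in> sector"
  by (simp add: sector_def abs_mult mult_left_mono)

lemma deriv2_bern_bound_far:
  assumes "w \<in> sector" "cmod w \<ge> 5"
  shows "cmod (deriv (deriv bern) w) \<le> 130 / cmod w ^ 2"
proof -
  define x E where "x = Re w" and "E = exp x"
  have w0: "w \<noteq> 0" using assms by auto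
  have x: "x \<ge> 5/2" "x \<ge> cmod w / 2" using norm_le_sector[OF assms(1)] assms(2) by (auto simp: x_def)
  have E: "E \<ge> 1 + x + x^2 / 2" unfolding E_def using exp_lower_Taylor_quadratic x by simp
  have E2: "E \<ge> x^2 / 2" "E \<ge> 2" using E x zero_le_power2[of x] by linarith+
  have n: "cmod (exp w) = E" by (simp add: E_def x_def)
  have "cmod (exp w + 1) \<le> E + 1" using norm_triangle_ineq[of "exp w" 1] n by simp
  then have num: "cmod (exp w + 1) \<le> 2 * E" using E2 by simp
  have "E \<le> 1 + cmod (exp w - 1)" using norm_triangle_sub[of "exp w" 1] n by simp
  then have "E / 2 \<le> cmod (exp w - 1)" using E2 by simp
  then have den: "(E / 2) ^ 3 \<le> cmod (exp w - 1) ^ 3" using E2 by (intro power_mono) auto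
  have "cmod (exp w * (exp w + 1) / (exp w - 1) ^ 3) = E * cmod (exp w + 1) / cmod (exp w - 1) ^ 3"
    by (simp add: norm_mult norm_divide norm_power n[simplified])
  also have "\<dots> \<le> E * (2 * E) / (E / 2) ^ 3"
    using num den E2 by (intro frac_le mult_left_mono) auto
  also have "\<dots> = 16 / E" using E2 by (simp add: field_simps power3_eq_cube)
  also have "\<dots> \<le> 16 / ((cmod w / 2)\<^sup>2 / 2)"
  proof (rule divide_left_mono)
    have "(cmod w / 2)\<^sup>2 \<le> x^2" using x by (intro power_mono) auto
    then show "(cmod w / 2)\<^sup>2 / 2 \<le> E" using E2 by simp
  qed (use E2 w0 in auto)
  also have "\<dots> = 128 / cmod w ^ 2" using w0 by (simp add: power_divide)
  finally have 1: "cmod (exp w * (exp w + 1) / (exp w - 1) ^ 3) \<le> 128 / cmod w ^ 2" .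
  have "cmod (2 / w ^ 3) = 2 / cmod w ^ 3" by (simp add: norm_divide norm_power)
  also have "\<dots> \<le> 2 / cmod w ^ 2"
    using assms by (intro divide_left_mono power_increasing) auto
  finally have 2: "cmod (2 / w ^ 3) \<le> 2 / cmod w ^ 2" .
  have "cmod (deriv (deriv bern) w) \<le> cmod (2 / w ^ 3) + cmod (exp w * (exp w + 1) / (exp w - 1) ^ 3)"
    using assms w0 sector_subset by (subst deriv2_bern) (auto intro!: norm_triangle_ineq4)
  also have "\<dots> \<le> 2 / cmod w ^ 2 + 128 / cmod w ^ 2" using 1 2 by (rule add_mono[rotated])
  finally show ?thesis by (simp add: add_divide_distrib[symmetric])
qed

lemma deriv2_bern_bound:
  obtains C where "C \<ge> 0" "\<And>w. w \<in> sector \<Longrightarrow> cmod (deriv (deriv bern) w) \<le> C / (1 + cmod w)\<^sup>2"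
proof -
  have "deriv (deriv bern) holomorphic_on bern_dom"
    by (intro holomorphic_deriv bern_holomorphic open_bern_dom)
  then have "continuous_on (sector \<inter> cball 0 5) (deriv (deriv bern))"
    using sector_subset by (meson holomorphic_on_imp_continuous_on continuous_on_subset inf.coboundedI1)
  moreover have "compact (sector \<inter> cball 0 5)" by (simp add: closed_Int_compact closed_sector)
  ultimately have "bounded (deriv (deriv bern) ` (sector \<inter> cball 0 5))"
    by (intro compact_imp_bounded compact_continuous_image)
  then obtain B where B: "B > 0" "\<And>w. w \<in> sector \<inter> cball 0 5 \<Longrightarrow> cmod (deriv (deriv bern) w) \<le> B"
    by (auto simp: bounded_pos)
  have "cmod (deriv (deriv bern) w) \<le> (36 * B + 520) / (1 + cmod w)\<^sup>2" if w: "w \<in> sector" for w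
  proof (cases "cmod w \<le> 5")
    case True
    then have "(1 + cmod w)\<^sup>2 \<le> 6\<^sup>2" by (intro power_mono) auto
    then have "B * (1 + cmod w)\<^sup>2 \<le> B * 36" using B by (intro mult_left_mono) auto
    then have "B * (1 + cmod w)\<^sup>2 \<le> 36 * B + 520" by linarith
    moreover have "(1 + cmod w)\<^sup>2 > 0" by (intro zero_less_power add_pos_nonneg) auto
    ultimately have "B \<le> (36 * B + 520) / (1 + cmod w)\<^sup>2" by (simp add: pos_le_divide_eq)
    then show ?thesis using B(2)[of w] w True by auto
  next
    case False
    have "cmod (deriv (deriv bern) w) \<le> 130 / cmod w ^ 2"
      using deriv2_bern_bound_far[OF w] False by simp
    also have "\<dots> = 520 / (2 * cmod w)\<^sup>2" by (simp add: power_mult_distrib)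
    also have "\<dots> \<le> (36 * B + 520) / (1 + cmod w)\<^sup>2"
    proof -
      have "1 + cmod w \<noteq> 0" using norm_ge_zero[of w] by linarith
      with False B show ?thesis by (intro frac_le power_mono) auto
    qed
    finally show ?thesis .
  qed
  then show thesis using that[of "36 * B + 520"] B by auto
qed

text \<open>
  Uniform in \<open>N\<close>; the terms with \<open>k \<ge> 1\<close> are dominated by the telescoping
  \<open>1 / (1 + (k - 1) * s) - 1 / (1 + k * s)\<close>.
\<close>
lemma sum_inverse_squares_le:
  fixes s :: real
  assumes "s \<ge> 0"
  shows "(\<Sum>k<N. s / (1 + real k * s)\<^sup>2) \<le> s + 1"
proof -
  have "(\<Sum>k<Suc N. s / (1 + real k * s)\<^sup>2) \<le> s + 1 - 1 / (1 + real N * s)" for N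
  proof (induction N)
    case (Suc N)
    define u where "u = 1 + real N * s"
    have u: "u \<ge> 1" "1 + real (Suc N) * s = u + s" using assms by (auto simp: u_def algebra_simps)
    have "s / (u + s)\<^sup>2 \<le> s / (u * (u + s))" unfolding power2_eq_square
      using u assms by (intro divide_left_mono mult_right_mono) auto
    also have "\<dots> = 1 / u - 1 / (u + s)" using u assms by (simp add: field_simps)
    finally show ?case using Suc.IH unfolding sum.lessThan_Suc[of _ "Suc N"] u(2) u_def[symmetric]
      by linarith
  qed simp
  from this[of N] have "(\<Sum>k<Suc N. s / (1 + real k * s)\<^sup>2) \<le> s + 1"
    using assms by (smt (verit) divide_nonneg_nonneg mult_nonneg_nonneg of_nat_0_le_iff)
  moreover have "(\<Sum>k<N. s / (1 + real k * s)\<^sup>2) \<le> (\<Sum>k<Suc N. s / (1 + real k * s)\<^sup>2)"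
    using assms by simp
  ultimately show ?thesis by linarith
qed

text \<open>
  One step of the comparison of sum and integral: on the segment from \<open>k * z\<close> to \<open>(k + 1) * z\<close> the
  derivative of \<open>bern\<close> differs from its value at the right end by at most \<open>\<bar>z\<bar>\<close> times the bound for
  the second derivative.
\<close>
lemma bern_step:
  assumes C: "C \<ge> 0" "\<And>w. w \<in> sector \<Longrightarrow> cmod (deriv (deriv bern) w) \<le> C / (1 + cmod w)\<^sup>2"
    and z: "z \<in> sector"
  shows "cmod (bern (of_nat (Suc k) * z) - bern (of_nat k * z) - z * deriv bern (of_nat (Suc k) * z))
       \<le> C * cmod z * (cmod z / (1 + real k * cmod z)\<^sup>2)"
proof -
  define x y where "x = of_nat k * z" and "y = of_nat (Suc k) * z"
  define B where "B = C / (1 + real k * cmod z)\<^sup>2"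
  have xy: "y - x = z" by (simp add: x_def y_def algebra_simps)
  have B0: "B \<ge> 0" using C by (simp add: B_def)
  let ?S = "closed_segment x y"
  have sub: "w \<in> sector \<and> real k * cmod z \<le> cmod w" if w: "w \<in> ?S" for w
  proof -
    obtain t where t: "0 \<le> t" "t \<le> 1" "w = (1 - t) *\<^sub>R x + t *\<^sub>R y"
      using w by (auto simp: closed_segment_def)
    have w: "w = of_real (real k + t) * z"
      by (simp add: t(3) x_def y_def scaleR_conv_of_real algebra_simps)
    have "w \<in> sector" unfolding w using t by (intro sector_scale z) auto
    moreover have "real k * cmod z \<le> (real k + t) * cmod z" using t by (intro mult_right_mono) auto
    moreover have "cmod w = (real k + t) * cmod z" using t unfolding w norm_mult norm_of_real by simp
    ultimately show ?thesis by simp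
  qed
  have dom: "w \<in> bern_dom" if "w \<in> ?S" for w using sub[OF that] sector_subset by blast
  have d1: "(bern has_field_derivative deriv bern w) (at w within T)" if "w \<in> bern_dom" for w T
    using bern_holomorphic open_bern_dom that by (meson holomorphic_derivI has_field_derivative_at_within)
  have d2: "(deriv bern has_field_derivative deriv (deriv bern) w) (at w within T)" if "w \<in> bern_dom" for w T
    using holomorphic_deriv[OF bern_holomorphic open_bern_dom] open_bern_dom that
    by (meson holomorphic_derivI has_field_derivative_at_within)
  have d2b: "cmod (deriv (deriv bern) w) \<le> B" if "w \<in> ?S" for w
  proof -
    have "C / (1 + cmod w)\<^sup>2 \<le> B" unfolding B_def using C sub[OF that]
      by (intro divide_left_mono power_mono) (auto intro!: mult_pos_pos zero_less_power add_pos_nonneg)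
    then show ?thesis using C(2)[of w] sub[OF that] by linarith
  qed
  have d1b: "cmod (deriv bern w - deriv bern y) \<le> B * cmod z" if "w \<in> ?S" for w
  proof -
    have "cmod (deriv bern w - deriv bern y) \<le> B * cmod (w - y)"
      by (rule field_differentiable_bound[of ?S "deriv bern" "deriv (deriv bern)"])
        (use that d2 d2b dom in auto)
    also have "cmod (w - y) \<le> cmod (x - y)" using that
      by (metis closed_segment_commute segment_bound1 norm_minus_commute)
    also have "cmod (x - y) = cmod z" using xy by (metis norm_minus_commute)
    finally show ?thesis using B0 by (simp add: mult_left_mono)
  qed
  have "cmod ((bern y - deriv bern y * y) - (bern x - deriv bern y * x)) \<le> B * cmod z * cmod (y - x)"
    by (rule field_differentiable_bound[of ?S "\<lambda>w. bern w - deriv bern y * w" "\<lambda>w. deriv bern w - deriv bern y"])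
      (use d1 d1b dom in \<open>auto intro!: derivative_eq_intros\<close>)
  also have "(bern y - deriv bern y * y) - (bern x - deriv bern y * x) = bern y - bern x - z * deriv bern y"
    unfolding xy[symmetric] by (simp add: algebra_simps)
  finally have "cmod (bern y - bern x - z * deriv bern y) \<le> B * cmod z * cmod z"
    by (simp only: xy)
  also have "\<dots> = C * cmod z * (cmod z / (1 + real k * cmod z)\<^sup>2)" by (simp add: B_def)
  finally show ?thesis unfolding x_def y_def .
qed

text \<open>
  Adding the steps over all \<open>k\<close>, the values of \<open>bern\<close> telescope to
  \<open>0 - bern 0 = - 1/2\<close>, which produces the term \<open>1 / (2 * z)\<close>; the sum of \<open>1 / (k * z)^2\<close> produces
  \<open>pi^2 / (6 * z^2)\<close>.
\<close>
lemma deriv_log_gf_approx: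
  obtains C where "C \<ge> 0" "\<And>z. z \<in> sector \<Longrightarrow> z \<noteq> 0 \<Longrightarrow>
     cmod (deriv log_gf z + of_real (pi\<^sup>2 / 6) / z\<^sup>2 - 1 / (2 * z)) \<le> C * (cmod z + 1)"
proof -
  obtain C where C: "C \<ge> 0" "\<And>w. w \<in> sector \<Longrightarrow> cmod (deriv (deriv bern) w) \<le> C / (1 + cmod w)\<^sup>2"
    using deriv2_bern_bound by blast
  have "cmod (deriv log_gf z + of_real (pi\<^sup>2 / 6) / z\<^sup>2 - 1 / (2 * z)) \<le> C * (cmod z + 1)"
    if z: "z \<in> sector" "z \<noteq> 0" for z
  proof -
    have Re: "Re z > 0" using sector_Re_pos z by blast
    have dom: "of_nat k * z \<in> bern_dom" for k
      using sector_scale[OF z(1), of "real k"] sector_subset by auto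
    define D where "D = (\<lambda>k. deriv bern (of_nat (Suc k) * z))"
    have le: "cmod (bern (of_nat N * z) - 1/2 - z * (\<Sum>k<N. D k)) \<le> C * cmod z * (cmod z + 1)" for N
    proof -
      have "bern (of_nat N * z) - 1/2 = (\<Sum>k<N. bern (of_nat (Suc k) * z) - bern (of_nat k * z))"
        by (subst sum_lessThan_telescope) (simp add: bern_0)
      then have "bern (of_nat N * z) - 1/2 - z * (\<Sum>k<N. D k)
          = (\<Sum>k<N. bern (of_nat (Suc k) * z) - bern (of_nat k * z) - z * D k)"
        by (simp add: sum_subtractf sum_distrib_left)
      also have "cmod \<dots> \<le> (\<Sum>k<N. C * cmod z * (cmod z / (1 + real k * cmod z)\<^sup>2))"
        unfolding D_def by (intro sum_norm_le bern_step C z)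
      also have "\<dots> = C * cmod z * (\<Sum>k<N. cmod z / (1 + real k * cmod z)\<^sup>2)"
        by (simp add: sum_distrib_left)
      also have "\<dots> \<le> C * cmod z * (cmod z + 1)"
        using C by (intro mult_left_mono sum_inverse_squares_le) auto
      finally show ?thesis .
    qed
    have lim1: "(\<lambda>N. \<Sum>k<N. D k) \<longlonglongrightarrow> - deriv log_gf z - of_real (pi\<^sup>2 / 6) / z\<^sup>2"
    proof -
      have "(\<lambda>k. complex_of_real (1 / (real k + 1)\<^sup>2)) sums of_real (pi\<^sup>2 / 6)"
        using inverse_squares_sums by (intro sums_of_real) (simp add: add.commute)
      then have "(\<lambda>k. complex_of_real (1 / (real k + 1)\<^sup>2) / z\<^sup>2) sums (of_real (pi\<^sup>2 / 6) / z\<^sup>2)"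
        by (rule sums_divide)
      from sums_diff[OF sums_minus[OF log_gf_derivative(1)[OF Re]] this]
      have "(\<lambda>k. - (- exp (of_nat (Suc k) * z) / (exp (of_nat (Suc k) * z) - 1)\<^sup>2)
           - complex_of_real (1 / (real k + 1)\<^sup>2) / z\<^sup>2) sums (- deriv log_gf z - of_real (pi\<^sup>2 / 6) / z\<^sup>2)" .
      also have "(\<lambda>k. - (- exp (of_nat (Suc k) * z) / (exp (of_nat (Suc k) * z) - 1)\<^sup>2)
           - complex_of_real (1 / (real k + 1)\<^sup>2) / z\<^sup>2) = D"
      proof
        fix k
        have "of_nat (Suc k) * z \<noteq> 0" using z by (simp del: of_nat_Suc)
        then show "- (- exp (of_nat (Suc k) * z) / (exp (of_nat (Suc k) * z) - 1)\<^sup>2)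
           - complex_of_real (1 / (real k + 1)\<^sup>2) / z\<^sup>2 = D k"
          unfolding D_def by (subst deriv_bern[OF dom]) (auto simp: power_mult_distrib add.commute)
      qed
      finally show ?thesis by (simp add: sums_def)
    qed
    have lim2: "(\<lambda>N. bern (of_nat N * z)) \<longlonglongrightarrow> 0"
    proof (rule Lim_null_comparison)
      show "(\<lambda>N. 2 / (Re z * real N)) \<longlonglongrightarrow> 0" using Re by real_asymp
      show "\<forall>\<^sub>F N in sequentially. cmod (bern (of_nat N * z)) \<le> 2 / (Re z * real N)"
        using eventually_gt_at_top[of 0]
      proof eventually_elim
        case (elim N)
        define w where "w = of_nat N * z"
        have w: "Re w = real N * Re z" "Re w > 0" "w \<noteq> 0" using elim Re by (auto simp: w_def)
        have "cmod (bern w) \<le> cmod (1 / w) + cmod (1 / (exp w - 1))"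
          using bern_eq[of w] dom[of N] w(3) unfolding w_def[symmetric] by (simp add: norm_triangle_ineq4)
        also have "\<dots> \<le> 1 / Re w + 1 / Re w" unfolding norm_divide norm_one
          using w complex_Re_le_cmod[of w] norm_exp_minus_one_ge[of w] exp_neq_one[of w]
          by (intro add_mono divide_left_mono) auto
        finally show ?case using w(1) by (simp add: w_def mult.commute)
      qed
    qed
    have "(\<lambda>N. cmod (bern (of_nat N * z) - 1/2 - z * (\<Sum>k<N. D k)))
       \<longlonglongrightarrow> cmod (0 - 1/2 - z * (- deriv log_gf z - of_real (pi\<^sup>2 / 6) / z\<^sup>2))"
      by (intro tendsto_intros lim1 lim2)
    then have "cmod (0 - 1/2 - z * (- deriv log_gf z - of_real (pi\<^sup>2 / 6) / z\<^sup>2)) \<le> C * cmod z * (cmod z + 1)"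
      by (rule LIMSEQ_le_const2) (use le in blast)
    also have "0 - 1/2 - z * (- deriv log_gf z - of_real (pi\<^sup>2 / 6) / z\<^sup>2)
        = z * (deriv log_gf z + of_real (pi\<^sup>2 / 6) / z\<^sup>2 - 1 / (2 * z))"
      using z by (simp add: field_simps)
    finally have "cmod z * cmod (deriv log_gf z + of_real (pi\<^sup>2 / 6) / z\<^sup>2 - 1 / (2 * z)) \<le> cmod z * (C * (cmod z + 1))"
      by (simp add: norm_mult mult_ac)
    then show ?thesis by (rule mult_left_le_imp_le) (use z in simp)
  qed
  then show thesis using that C(1) by blast
qed

text \<open>
  The function \<open>H\<close>: what remains of \<open>Q\<close> after removing its singular part at \<open>0\<close>.
\<close>
definition gf_correction :: "complex \<Rightarrow> complex" where
  "gf_correction z = log_gf z - of_real (pi\<^sup>2 / 6) / z - Ln z / 2"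

lemma exp_log_gf:
  assumes "z \<noteq> 0"
  shows "exp (log_gf z) = exp (gf_correction z) * csqrt z * exp (of_real (pi\<^sup>2 / 6) / z)"
  using assms by (simp add: gf_correction_def csqrt_exp_Ln exp_diff)

lemma gf_correction_lipschitz:
  obtains C where "C > 0" "\<And>z w. z \<in> sector \<Longrightarrow> w \<in> sector \<Longrightarrow> z \<noteq> 0 \<Longrightarrow> w \<noteq> 0 \<Longrightarrow>
    cmod z \<le> 2 \<Longrightarrow> cmod w \<le> 2 \<Longrightarrow> cmod (gf_correction z - gf_correction w) \<le> C * cmod (z - w)"
proof -
  obtain C where C: "C \<ge> 0" "\<And>z. z \<in> sector \<Longrightarrow> z \<noteq> 0 \<Longrightarrow>
     cmod (deriv log_gf z + of_real (pi\<^sup>2 / 6) / z\<^sup>2 - 1 / (2 * z)) \<le> C * (cmod z + 1)"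
    using deriv_log_gf_approx by blast
  define S where "S = sector \<inter> {z. Re z > 0} \<inter> cball 0 2"
  have cv: "convex S" unfolding S_def
    by (intro convex_Int convex_sector convex_halfspace_Re_gt convex_cball)
  have "cmod (gf_correction z - gf_correction w) \<le> (3 * C) * cmod (z - w)" if "z \<in> S" "w \<in> S" for z w
  proof (rule field_differentiable_bound[OF cv])
    fix x assume x: "x \<in> S"
    then have x': "x \<in> sector" "Re x > 0" "x \<noteq> 0" "cmod x \<le> 2" by (auto simp: S_def)
    have "(gf_correction has_field_derivative
       deriv log_gf x + of_real (pi\<^sup>2 / 6) / x\<^sup>2 - 1 / (2 * x)) (at x)"
      unfolding gf_correction_def[abs_def] using x' log_gf_derivative(2)[OF x'(2)]
      by (auto intro!: derivative_eq_intros simp: power2_eq_square complex_nonpos_Reals_iff field_simps)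
    then show "(gf_correction has_field_derivative
       deriv log_gf x + of_real (pi\<^sup>2 / 6) / x\<^sup>2 - 1 / (2 * x)) (at x within S)"
      by (rule has_field_derivative_at_within)
    have "C * (cmod x + 1) \<le> C * 3" using x' C by (intro mult_left_mono) auto
    then show "cmod (deriv log_gf x + of_real (pi\<^sup>2 / 6) / x\<^sup>2 - 1 / (2 * x)) \<le> 3 * C"
      using C(2)[OF x'(1,3)] by linarith
  qed (use that in auto)
  then have "cmod (gf_correction z - gf_correction w) \<le> (3 * C + 1) * cmod (z - w)" if "z \<in> S" "w \<in> S" for z w
    using that by (smt (verit) mult_right_mono norm_ge_zero)
  then show thesis using that[of "3 * C + 1"] C(1) sector_Re_pos by (auto simp: S_def)
qed

section \<open>Coefficient integrals and the minor arc\<close>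

text \<open>
  The fundamental theorem of calculus along a vertical segment; the factor \<open>\<i>\<close> is the derivative
  of the parametrization.
\<close>
lemma has_integral_vertical:
  fixes a :: complex and l u :: real
  assumes "l \<le> u"
    and "\<And>t. l \<le> t \<Longrightarrow> t \<le> u \<Longrightarrow> (H has_field_derivative h (a + \<i> * of_real t)) (at (a + \<i> * of_real t))"
  shows "((\<lambda>t. h (a + \<i> * of_real t)) has_integral (H (a + \<i> * of_real u) - H (a + \<i> * of_real l)) / \<i>) {l..u}"
proof -
  define F where "F = (\<lambda>t::real. H (a + \<i> * of_real t))"
  have "((\<lambda>t. \<i> * h (a + \<i> * of_real t)) has_integral F u - F l) {l..u}"
  proof (rule fundamental_theorem_of_calculus)
    fix t :: real assume t: "t \<in> {l..u}"
    have "((\<lambda>t. a + \<i> * complex_of_real t) has_vector_derivative \<i>) (at t)"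
      by (auto intro!: derivative_eq_intros)
    from field_vector_diff_chain_at[OF this assms(2)] t
    have "(F has_vector_derivative \<i> * h (a + \<i> * of_real t)) (at t)"
      by (auto simp: F_def o_def)
    then show "(F has_vector_derivative \<i> * h (a + \<i> * of_real t)) (at t within {l..u})"
      by (rule has_vector_derivative_at_within)
  qed (rule assms)
  from has_integral_mult_right[OF this, of "1 / \<i>"] show ?thesis
    by (simp add: F_def)
qed

text \<open>
  Cauchy's coefficient formula: the series of the generating function converges uniformly on the
  segment, and only the term with \<open>k = n\<close> has a nonzero integral over a full period.
\<close>
lemma partition_count_has_integral:
  fixes a :: real
  assumes "a > 0"
  defines "z \<equiv> \<lambda>y. Complex a y"
  shows "((\<lambda>y. exp (log_gf (z y)) * exp (of_nat n * z y)) has_integral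
            of_real (2 * pi * real (partition_count n))) {-pi..pi}"
proof -
  define f where "f k y = of_nat (partition_count k) * exp (- z y) ^ k * exp (of_nat n * z y)" for k y
  have zeq: "z y = of_real a + \<i> * of_real y" for y by (simp add: z_def complex_eq_iff)
  have f: "f k y = of_nat (partition_count k) * exp ((of_nat n - of_nat k) * z y)" for k y
    by (simp add: f_def exp_of_nat_mult[symmetric] exp_add[symmetric] mult.assoc algebra_simps)
  define M where "M k = real (partition_count k) * cmod (exp (- of_real a)) ^ k * exp (real n * a)" for k
  have uni: "uniform_limit {-pi..pi} (\<lambda>N y. \<Sum>k<N. f k y) (\<lambda>y. \<Sum>k. f k y) sequentially"
  proof (rule Weierstrass_m_test)
    show "cmod (f k y) \<le> M k" for k y
      by (simp add: f_def M_def norm_mult norm_power z_def)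
    show "summable M" unfolding M_def
      using partition_gf(1)[of "of_real a"] assms by (intro summable_mult2) auto
  qed
  have lim: "(\<Sum>k. f k y) = exp (log_gf (z y)) * exp (of_nat n * z y)" for y
    using sums_mult2[OF partition_gf(2)[of "z y"], of "exp (of_nat n * z y)"] assms
    by (simp add: f_def sums_iff z_def)
  have cont: "continuous_on {-pi..pi} (\<lambda>y. \<Sum>k<N. f k y)" for N
    unfolding f zeq by (intro continuous_intros)
  obtain I J where IJ: "\<And>N. ((\<lambda>y. \<Sum>k<N. f k y) has_integral I N) {-pi..pi}"
    "((\<lambda>y. \<Sum>k. f k y) has_integral J) {-pi..pi}" "I \<longlonglongrightarrow> J"
    by (rule uniform_limit_integral[OF uni cont]) auto
  have tm: "(f k has_integral (if k = n then of_real (2 * pi * real (partition_count n)) else 0)) {-pi..pi}" for k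
  proof (cases "k = n")
    case True
    have "((\<lambda>y. complex_of_nat (partition_count n)) has_integral
       (pi - (-pi)) *\<^sub>R complex_of_nat (partition_count n)) {-pi..pi}"
      using has_integral_const_real[of "complex_of_nat (partition_count n)" "-pi" pi] by simp
    moreover have "f k = (\<lambda>y. complex_of_nat (partition_count n))" using True by (simp add: f fun_eq_iff)
    ultimately show ?thesis using True by (simp add: scaleR_conv_of_real mult_ac)
  next
    case False
    define m where "m = int n - int k"
    define d :: complex where "d = of_int m"
    have d: "d = of_nat n - of_nat k" "d \<noteq> 0" using False by (auto simp: d_def m_def)
    define F where "F w = of_nat (partition_count k) * exp (d * w) / d" for w
    have "((\<lambda>y. of_nat (partition_count k) * exp (d * (of_real a + \<i> * of_real y))) has_integral
        (F (of_real a + \<i> * of_real pi) - F (of_real a + \<i> * of_real (-pi))) / \<i>) {-pi..pi}"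
      by (rule has_integral_vertical) (use d(2) in \<open>auto simp: F_def intro!: derivative_eq_intros\<close>)
    then have "(f k has_integral
        (F (of_real a + \<i> * of_real pi) - F (of_real a + \<i> * of_real (-pi))) / \<i>) {-pi..pi}"
      by (simp add: f[abs_def] d(1) zeq)
    moreover have "exp (d * (of_real a + \<i> * of_real pi)) = exp (d * (of_real a + \<i> * of_real (-pi)))"
      by (subst exp_eq) (auto simp: d_def algebra_simps intro!: exI[of _ m])
    then have "F (of_real a + \<i> * of_real pi) = F (of_real a + \<i> * of_real (-pi))" by (simp only: F_def)
    ultimately show ?thesis using False by simp
  qed
  have "I N = of_real (2 * pi * real (partition_count n))" if "N > n" for N
  proof -
    have "((\<lambda>y. \<Sum>k<N. f k y) has_integral
        (\<Sum>k<N. if k = n then of_real (2 * pi * real (partition_count n)) else 0)) {-pi..pi}"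
      by (intro has_integral_sum tm) auto
    then show ?thesis using has_integral_unique[OF IJ(1)[of N]] that by simp
  qed
  then have "I \<longlonglongrightarrow> of_real (2 * pi * real (partition_count n))"
    by (intro tendsto_eventually eventually_mono[OF eventually_gt_at_top[of n]])
  then show ?thesis using IJ(2,3) LIMSEQ_unique unfolding lim by blast
qed

lemma sin_ge_half:
  fixes x :: real
  assumes "0 \<le> x" "x \<le> 1" shows "x / 2 \<le> sin x"
proof -
  have "sin 0 - 0 / 2 \<le> sin x - x / 2"
  proof (rule DERIV_nonneg_imp_nondecreasing[OF assms(1)])
    fix t :: real assume t: "0 \<le> t" "t \<le> x"
    have "cos (pi / 3) \<le> cos t" using t assms pi_gt3 by (intro cos_monotone_0_pi_le) auto
    then have "1 / 2 \<le> cos t" by (simp add: cos_60)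
    then show "\<exists>y. ((\<lambda>x. sin x - x / 2) has_real_derivative y) (at t) \<and> 0 \<le> y"
      by (intro exI[of _ "cos t - 1 / 2"]) (auto intro!: derivative_eq_intros)
  qed
  then show ?thesis by simp
qed

lemma cos_le_one_minus:
  fixes x :: real
  assumes "0 \<le> x" "x \<le> 1" shows "cos x \<le> 1 - x\<^sup>2 / 4"
proof -
  have "1 - 0\<^sup>2 / 4 - cos 0 \<le> 1 - x\<^sup>2 / 4 - cos x"
  proof (rule DERIV_nonneg_imp_nondecreasing[OF assms(1)])
    fix t :: real assume t: "0 \<le> t" "t \<le> x"
    then show "\<exists>y. ((\<lambda>x. 1 - x\<^sup>2 / 4 - cos x) has_real_derivative y) (at t) \<and> 0 \<le> y"
      using sin_ge_half[of t] assms
      by (intro exI[of _ "sin t - t / 2"]) (auto intro!: derivative_eq_intros)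
  qed
  then show ?thesis by simp
qed

text \<open>
  The square of the right-hand side is \<open>(exp a - 1)^2 + 2 * exp a * (1 - cos y)\<close>, which on the minor
  arc is at least \<open>a^2 + a^2 / 2\<close>.
\<close>
lemma norm_exp_minus_one_minor:
  assumes "0 < a" "a \<le> 1" "a \<le> \<bar>y\<bar>" "\<bar>y\<bar> \<le> pi"
  shows "6 / 5 * a \<le> cmod (exp (Complex a y) - 1)"
proof (rule power2_le_imp_le)
  define E where "E = exp a"
  have E: "E \<ge> 1 + a" by (simp add: E_def)
  have "cos y = cos \<bar>y\<bar>" by simp
  also have "\<dots> \<le> cos a" using assms by (intro cos_monotone_0_pi_le) auto
  also have "\<dots> \<le> 1 - a\<^sup>2 / 4" using assms by (intro cos_le_one_minus) auto
  finally have c: "a\<^sup>2 / 4 \<le> 1 - cos y" by simp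
  have "(6 / 5 * a)\<^sup>2 \<le> a\<^sup>2 + 2 * 1 * (a\<^sup>2 / 4)" by (simp add: power2_eq_square)
  also have "\<dots> \<le> (E - 1)\<^sup>2 + 2 * E * (1 - cos y)"
    using E assms c by (intro add_mono power_mono mult_mono) auto
  also have "\<dots> = (E * cos y - 1)\<^sup>2 + (E * sin y)\<^sup>2"
    using sin_squared_eq[of y] by (simp add: power2_eq_square algebra_simps) (simp add: distrib_left[symmetric])
  also have "\<dots> = (cmod (exp (Complex a y) - 1))\<^sup>2"
    unfolding cmod_power2 by (simp add: Re_exp Im_exp E_def)
  finally show "(6 / 5 * a)\<^sup>2 \<le> (cmod (exp (Complex a y) - 1))\<^sup>2" .
qed simp

text \<open>
  On the minor arc the first term of \<open>Q\<close> is at most \<open>5 / (6 * a)\<close>; the others are estimated by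
  \<open>1 / (m^2 * a)\<close> as on the real axis.  The bound is thus by a factor \<open>exp (- 1 / (6 * a))\<close> smaller
  than \<open>exp (c^2 / a)\<close>.
\<close>
lemma log_gf_minor_bound:
  assumes "0 < a" "a \<le> 1" "a \<le> \<bar>y\<bar>" "\<bar>y\<bar> \<le> pi"
  shows "cmod (exp (log_gf (Complex a y))) \<le> exp ((pi\<^sup>2 / 6 - 1 / 6) / a)"
proof -
  define z where "z = Complex a y"
  have Re: "Re z = a" "Re z > 0" using assms by (auto simp: z_def)
  define t where "t m = 1 / (of_nat (Suc m) * (exp (of_nat (Suc m) * z) - 1))" for m
  \<comment> \<open>The index is shifted by one: \<open>m = 0\<close> belongs to the first term.\<close>
  define T where "T m = (if m = 0 then 5 / (6 * a) else 1 / a * (1 / real (Suc m)^2))" for m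
  have s: "t sums log_gf z" unfolding t_def by (rule log_gf_sums[OF Re(2)])
  have "(\<lambda>m. 1 / a * (1 / real (Suc m)^2)) sums (1 / a * (pi\<^sup>2 / 6))"
    using inverse_squares_sums by (intro sums_mult) (simp add: add.commute)
  from sums_add[OF this sums_single[of 0 "\<lambda>_. 5 / (6 * a) - 1 / a"]]
  have "(\<lambda>m. 1 / a * (1 / real (Suc m)^2) + (if m = 0 then 5 / (6 * a) - 1 / a else 0))
      sums (1 / a * (pi\<^sup>2 / 6) + (5 / (6 * a) - 1 / a))" .
  also have "(\<lambda>m. 1 / a * (1 / real (Suc m)^2) + (if m = 0 then 5 / (6 * a) - 1 / a else 0)) = T"
    by (auto simp: T_def)
  also have "1 / a * (pi\<^sup>2 / 6) + (5 / (6 * a) - 1 / a) = (pi\<^sup>2 / 6 - 1 / 6) / a"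
    using assms by (simp add: field_simps)
  finally have T: "T sums ((pi\<^sup>2 / 6 - 1 / 6) / a)" .
  have le: "cmod (t m) \<le> T m" for m
  proof (cases "m = 0")
    case True
    have p: "6 / 5 * a \<le> cmod (exp z - 1)" unfolding z_def by (rule norm_exp_minus_one_minor[OF assms])
    then have "0 < cmod (exp z - 1)" using assms by (smt (verit) mult_pos_pos zero_less_divide_iff)
    then have "1 / cmod (exp z - 1) \<le> 1 / (6 / 5 * a)"
      using p assms by (intro divide_left_mono mult_pos_pos) auto
    then show ?thesis using True by (simp add: t_def T_def norm_divide)
  next
    case False
    then show ?thesis using norm_log_gf_term_le[OF Re(2), of m] Re(1) by (simp add: t_def T_def del: of_nat_Suc)
  qed
  have "cmod (\<Sum>m. t m) \<le> (\<Sum>m. T m)"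
    using T le by (intro norm_suminf_le) (auto simp: sums_iff)
  then have "cmod (log_gf z) \<le> (pi\<^sup>2 / 6 - 1 / 6) / a" using s T by (simp add: sums_iff)
  then have "Re (log_gf z) \<le> (pi\<^sup>2 / 6 - 1 / 6) / a" using complex_Re_le_cmod order_trans by blast
  then show ?thesis by (simp add: z_def)
qed

section \<open>The saddle point integrals\<close>

text \<open>
  An integrable majorant of width \<open>1 / sqrt X\<close>; a Lorentz profile replaces the Gaussian because its
  primitive is elementary.
\<close>
lemma integral_lorentz_bound:
  fixes f :: "real \<Rightarrow> complex"
  assumes X: "X > 0" and f: "continuous_on {-1..1} f"
    and le: "\<And>t. \<bar>t\<bar> \<le> 1 \<Longrightarrow> cmod (f t) \<le> B / (1 + X * t\<^sup>2 / 2)"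
  shows "cmod (integral {-1..1} f) \<le> 5 * B / sqrt X"
    and "integral {-1..1} (\<lambda>t. cmod (f t)) \<le> 5 * B / sqrt X"
proof -
  define s where "s = sqrt (X / 2)"
  have s: "s > 0" "s\<^sup>2 = X / 2" using X by (auto simp: s_def)
  have B: "B \<ge> 0" using le[of 0] order_trans[OF norm_ge_zero[of "f 0"]] by simp
  define g where "g t = B / s * arctan (s * t)" for t
  have "((\<lambda>t. B / (1 + X * t\<^sup>2 / 2)) has_integral g 1 - g (-1)) {-1..1}"
  proof (rule fundamental_theorem_of_calculus)
    fix t :: real
    have e: "X * t\<^sup>2 / 2 = (s * t)\<^sup>2" using s by (simp add: power_mult_distrib)
    have "(g has_real_derivative B / s * (inverse (1 + (s * t)\<^sup>2) * s)) (at t)"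
      unfolding g_def by (auto intro!: derivative_eq_intros)
    also have "B / s * (inverse (1 + (s * t)\<^sup>2) * s) = B / (1 + X * t\<^sup>2 / 2)"
      unfolding e using s(1) by (simp add: divide_inverse)
    finally have "(g has_real_derivative B / (1 + X * t\<^sup>2 / 2)) (at t)" .
    then show "(g has_vector_derivative B / (1 + X * t\<^sup>2 / 2)) (at t within {-1..1})"
      using has_real_derivative_iff_has_vector_derivative has_vector_derivative_at_within by blast
  qed simp
  then have int: "(\<lambda>t. B / (1 + X * t\<^sup>2 / 2)) integrable_on {-1..1}"
    "integral {-1..1} (\<lambda>t. B / (1 + X * t\<^sup>2 / 2)) = g 1 - g (-1)"
    by (auto simp: has_integral_iff)
  have "g 1 - g (-1) = 2 * (B / s) * arctan s" by (simp add: g_def arctan_minus)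
  also have "\<dots> \<le> 2 * (B / s) * (pi / 2)"
    using B s arctan_ubound[of s] by (intro mult_left_mono) auto
  also have "\<dots> = B * (pi * sqrt 2) / sqrt X" by (simp add: s_def real_sqrt_divide)
  also have "\<dots> \<le> B * 5 / sqrt X"
  proof -
    have "pi * sqrt 2 \<le> 3.2 * 1.5"
      using pi_approx by (intro mult_mono real_le_lsqrt) (auto simp: power2_eq_square)
    then show ?thesis using B X by (intro divide_right_mono mult_left_mono) auto
  qed
  finally have fin: "g 1 - g (-1) \<le> 5 * B / sqrt X" by (simp add: mult.commute)
  show "cmod (integral {-1..1} f) \<le> 5 * B / sqrt X"
    using integral_norm_bound_integral[OF integrable_continuous_real[OF f] int(1)] le fin int(2)
    by fastforce
  show "integral {-1..1} (\<lambda>t. cmod (f t)) \<le> 5 * B / sqrt X"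
    using integral_le[OF integrable_continuous_real[OF continuous_on_norm[OF f]] int(1)] le fin int(2)
    by fastforce
qed

text \<open>
  The exponential whose saddle point is \<open>z = 1\<close>, where it has the value \<open>exp (2 * X)\<close>.
\<close>
definition saddle_exp :: "real \<Rightarrow> complex \<Rightarrow> complex" where
  "saddle_exp X z = exp (of_real X * (z + 1 / z))"

lemma exp_minus_le_lorentz:
  fixes x :: real
  assumes "x \<ge> 0"
  shows "exp (-x) \<le> 1 / (1 + x)" and "x * exp (-x) \<le> 2 / (1 + x)"
proof -
  have "1 + x \<le> exp x" by simp
  then show "exp (-x) \<le> 1 / (1 + x)" using assms by (simp add: exp_minus field_simps)
  have "1 + x + x\<^sup>2 / 2 \<le> exp x" by (rule exp_lower_Taylor_quadratic[OF assms])
  then have "x * (1 + x) \<le> 2 * exp x" using assms by (simp add: power2_eq_square algebra_simps)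
  then show "x * exp (-x) \<le> 2 / (1 + x)" using assms by (simp add: exp_minus field_simps)
qed

text \<open>
  On the line \<open>Re z = 1\<close> the real part of \<open>z + 1 / z\<close> is \<open>1 + 1 / (1 + t^2)\<close>, which is at most
  \<open>2 - t^2 / 2\<close> for \<open>\<bar>t\<bar> \<le> 1\<close>.
\<close>
lemma norm_saddle_exp:
  assumes "\<bar>t\<bar> \<le> 1" "X \<ge> 0"
  shows "cmod (saddle_exp X (1 + \<i> * of_real t)) \<le> exp (2 * X) * exp (- (X * t\<^sup>2 / 2))"
proof -
  have t2: "t\<^sup>2 \<le> 1" using assms by (simp add: abs_square_le_1)
  have "Re (1 / (1 + \<i> * of_real t)) = 1 / (1 + t\<^sup>2)"
    by (simp add: Re_divide power2_eq_square)
  then have "cmod (saddle_exp X (1 + \<i> * of_real t)) = exp (X * (1 + 1 / (1 + t\<^sup>2)))"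
    by (simp add: saddle_exp_def)
  also have "1 / (1 + t\<^sup>2) \<le> 1 - t\<^sup>2 / 2"
  proof -
    have "1 \<le> (1 - t\<^sup>2 / 2) * (1 + t\<^sup>2)"
      using t2 mult_left_mono[OF t2, of "t\<^sup>2"] by (simp add: algebra_simps)
    then show ?thesis by (simp add: pos_divide_le_eq add_pos_nonneg)
  qed
  then have "X * (1 + 1 / (1 + t\<^sup>2)) \<le> 2 * X + - (X * t\<^sup>2 / 2)"
    using mult_left_mono[of "1 + 1 / (1 + t\<^sup>2)" "2 - t\<^sup>2 / 2" X] assms by (simp add: algebra_simps)
  then have "exp (X * (1 + 1 / (1 + t\<^sup>2))) \<le> exp (2 * X) * exp (- (X * t\<^sup>2 / 2))"
    unfolding exp_add[symmetric] by (subst exp_le_cancel_iff)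
  finally show ?thesis .
qed

lemma norm_saddle_exp_end: "cmod (saddle_exp X (1 + \<i>)) = exp (3/2 * X)" "cmod (saddle_exp X (1 - \<i>)) = exp (3/2 * X)"
  by (auto simp: saddle_exp_def Re_divide)

lemma vertical_not_nonpos [simp]: "1 + \<i> * complex_of_real t \<notin> \<real>\<^sub>\<le>\<^sub>0"
  by (simp add: complex_nonpos_Reals_iff)

lemma norm_csqrt_vertical:
  assumes "\<bar>t\<bar> \<le> 1"
  shows "cmod (csqrt (1 + \<i> * of_real t)) \<le> 2" "1 \<le> cmod (csqrt (1 + \<i> * of_real t))"
proof -
  have "cmod (1 + \<i> * of_real t) \<le> cmod 1 + cmod (\<i> * of_real t)" by (rule norm_triangle_ineq)
  also have "\<dots> \<le> 2" using assms by (simp add: norm_mult)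
  finally have "sqrt (cmod (1 + \<i> * of_real t)) \<le> 2" by (intro real_le_lsqrt) auto
  then show "cmod (csqrt (1 + \<i> * of_real t)) \<le> 2" by simp
  have "1 \<le> cmod (1 + \<i> * of_real t)" using complex_Re_le_cmod[of "1 + \<i> * of_real t"] by simp
  then show "1 \<le> cmod (csqrt (1 + \<i> * of_real t))" by simp
qed

lemma continuous_on_saddle_exp [continuous_intros]:
  "continuous_on {-1..1} (\<lambda>t::real. saddle_exp X (1 + \<i> * of_real t))"
  "continuous_on {-1..1} (\<lambda>t::real. csqrt (1 + \<i> * of_real t))"
proof -
  have nz: "1 + \<i> * complex_of_real t \<noteq> 0" for t by (simp add: complex_eq_iff)
  show "continuous_on {-1..1} (\<lambda>t::real. saddle_exp X (1 + \<i> * of_real t))"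
    unfolding saddle_exp_def using nz by (intro continuous_intros) auto
  have "continuous_on {-1..1} (csqrt \<circ> (\<lambda>t::real. 1 + \<i> * of_real t))"
  proof (rule continuous_on_compose)
    show "continuous_on ((\<lambda>t::real. 1 + \<i> * complex_of_real t) ` {-1..1}) csqrt"
      by (intro continuous_at_imp_continuous_on) (auto intro: continuous_at_csqrt)
  qed (intro continuous_intros)
  then show "continuous_on {-1..1} (\<lambda>t::real. csqrt (1 + \<i> * of_real t))" by (simp add: o_def)
qed

lemma integral_saddle_bounds:
  assumes "X > 0"
  shows "integral {-1..1} (\<lambda>t. cmod (csqrt (1 + \<i> * of_real t) * saddle_exp X (1 + \<i> * of_real t))) \<le> 10 * exp (2 * X) / sqrt X"
    and "integral {-1..1} (\<lambda>t. cmod (of_real (t\<^sup>2) * (csqrt (1 + \<i> * of_real t) * saddle_exp X (1 + \<i> * of_real t)))) \<le> 40 * exp (2 * X) / (X * sqrt X)"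
    and "cmod (integral {-1..1} (\<lambda>t. saddle_exp X (1 + \<i> * of_real t) / csqrt (1 + \<i> * of_real t))) \<le> 5 * exp (2 * X) / sqrt X"
proof -
  have s: "cmod (saddle_exp X (1 + \<i> * of_real t)) \<le> exp (2 * X) / (1 + X * t\<^sup>2 / 2)"
    and s2: "t\<^sup>2 * cmod (saddle_exp X (1 + \<i> * of_real t)) \<le> 4 / X * exp (2 * X) / (1 + X * t\<^sup>2 / 2)"
    if "\<bar>t\<bar> \<le> 1" for t
  proof -
    have x: "X * t\<^sup>2 / 2 \<ge> 0" using assms by simp
    note n = norm_saddle_exp[OF that less_imp_le[OF assms]]
    have "exp (2 * X) * exp (- (X * t\<^sup>2 / 2)) \<le> exp (2 * X) * (1 / (1 + X * t\<^sup>2 / 2))"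
      by (intro mult_left_mono exp_minus_le_lorentz x) auto
    with n show "cmod (saddle_exp X (1 + \<i> * of_real t)) \<le> exp (2 * X) / (1 + X * t\<^sup>2 / 2)" by simp
    have "t\<^sup>2 * cmod (saddle_exp X (1 + \<i> * of_real t)) \<le> t\<^sup>2 * (exp (2 * X) * exp (- (X * t\<^sup>2 / 2)))"
      by (intro mult_left_mono n) auto
    also have "\<dots> = 2 / X * exp (2 * X) * (X * t\<^sup>2 / 2 * exp (- (X * t\<^sup>2 / 2)))"
      using assms by simp
    also have "\<dots> \<le> 2 / X * exp (2 * X) * (2 / (1 + X * t\<^sup>2 / 2))"
      using assms by (intro mult_left_mono exp_minus_le_lorentz x) auto
    finally show "t\<^sup>2 * cmod (saddle_exp X (1 + \<i> * of_real t)) \<le> 4 / X * exp (2 * X) / (1 + X * t\<^sup>2 / 2)"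
      by simp
  qed
  have r: "cmod (csqrt (1 + \<i> * of_real t)) \<le> 2" "1 \<le> cmod (csqrt (1 + \<i> * of_real t))" if "\<bar>t\<bar> \<le> 1" for t
    using norm_csqrt_vertical[OF that] .
  have "1 + \<i> * complex_of_real t \<noteq> 0" for t by (simp add: complex_eq_iff)
  then have r0: "csqrt (1 + \<i> * of_real t) \<noteq> 0" for t using csqrt_eq_0 by blast
  have "integral {-1..1} (\<lambda>t. cmod (csqrt (1 + \<i> * of_real t) * saddle_exp X (1 + \<i> * of_real t))) \<le> 5 * (2 * exp (2 * X)) / sqrt X"
  proof (rule integral_lorentz_bound(2)[OF assms])
    fix t :: real assume t: "\<bar>t\<bar> \<le> 1"
    show "cmod (csqrt (1 + \<i> * of_real t) * saddle_exp X (1 + \<i> * of_real t)) \<le> 2 * exp (2 * X) / (1 + X * t\<^sup>2 / 2)"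
      using mult_mono[OF r(1)[OF t] s[OF t]] by (simp only: norm_mult) simp
  qed (intro continuous_intros)
  then show "integral {-1..1} (\<lambda>t. cmod (csqrt (1 + \<i> * of_real t) * saddle_exp X (1 + \<i> * of_real t))) \<le> 10 * exp (2 * X) / sqrt X"
    by simp
  have "integral {-1..1} (\<lambda>t. cmod (of_real (t\<^sup>2) * (csqrt (1 + \<i> * of_real t) * saddle_exp X (1 + \<i> * of_real t)))) \<le> 5 * (8 / X * exp (2 * X)) / sqrt X"
  proof (rule integral_lorentz_bound(2)[OF assms])
    fix t :: real assume t: "\<bar>t\<bar> \<le> 1"
    show "cmod (of_real (t\<^sup>2) * (csqrt (1 + \<i> * of_real t) * saddle_exp X (1 + \<i> * of_real t))) \<le> 8 / X * exp (2 * X) / (1 + X * t\<^sup>2 / 2)"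
      using mult_mono[OF r(1)[OF t] s2[OF t]] by (simp only: norm_mult norm_of_real abs_power2) (simp add: mult_ac)
  qed (intro continuous_intros)
  then show "integral {-1..1} (\<lambda>t. cmod (of_real (t\<^sup>2) * (csqrt (1 + \<i> * of_real t) * saddle_exp X (1 + \<i> * of_real t)))) \<le> 40 * exp (2 * X) / (X * sqrt X)"
    by simp
  show "cmod (integral {-1..1} (\<lambda>t. saddle_exp X (1 + \<i> * of_real t) / csqrt (1 + \<i> * of_real t))) \<le> 5 * exp (2 * X) / sqrt X"
  proof (rule integral_lorentz_bound(1)[OF assms])
    fix t :: real assume t: "\<bar>t\<bar> \<le> 1"
    show "cmod (saddle_exp X (1 + \<i> * of_real t) / csqrt (1 + \<i> * of_real t)) \<le> exp (2 * X) / (1 + X * t\<^sup>2 / 2)"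
      using frac_le[OF _ s[OF t] _ r(2)[OF t]] assms by (simp add: norm_divide)
  qed (use r0 in \<open>intro continuous_intros, auto\<close>)
qed

lemma ex_gauss_primitive: "\<exists>G. \<forall>w::complex. (G has_field_derivative exp (w\<^sup>2)) (at w)"
proof -
  have "(\<lambda>w::complex. exp (w\<^sup>2)) holomorphic_on UNIV" by (intro holomorphic_intros)
  then obtain G :: "complex \<Rightarrow> complex" where "\<And>w. w \<in> UNIV \<Longrightarrow> (G has_field_derivative exp (w\<^sup>2)) (at w within UNIV)"
    using holomorphic_convex_primitive'[of UNIV "\<lambda>w. exp (w\<^sup>2)"] by auto
  then show ?thesis by auto
qed

lemma gauss_primitive_upper:
  assumes G: "\<And>w. (G has_field_derivative exp (w\<^sup>2)) (at w)" and "Re (w\<^sup>2) \<ge> 0"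
  shows "cmod (G w - G 0) \<le> exp (Re (w\<^sup>2)) * cmod w"
proof -
  have "cmod (G w - G 0) \<le> exp (Re (w\<^sup>2)) * cmod (w - 0)"
  proof (rule field_differentiable_bound[of "closed_segment 0 w" G "\<lambda>w. exp (w\<^sup>2)"])
    fix x assume "x \<in> closed_segment 0 w"
    then obtain t where t: "0 \<le> t" "t \<le> 1" "x = t *\<^sub>R w" by (auto simp: closed_segment_def)
    show "(G has_field_derivative exp (x\<^sup>2)) (at x within closed_segment 0 w)"
      by (rule has_field_derivative_at_within[OF G])
    have "x\<^sup>2 = of_real (t\<^sup>2) * w\<^sup>2" unfolding t(3) scaleR_conv_of_real by (simp add: power_mult_distrib)
    then have "Re (x\<^sup>2) = t\<^sup>2 * Re (w\<^sup>2)" by (simp only: times_complex.simps Re_complex_of_real Im_complex_of_real mult_zero_left diff_zero)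
    also have "\<dots> \<le> 1 * Re (w\<^sup>2)" using t assms(2) by (intro mult_right_mono) (auto simp: power_le_one)
    finally show "cmod (exp (x\<^sup>2)) \<le> exp (Re (w\<^sup>2))" by simp
  qed auto
  then show ?thesis by simp
qed

text \<open>
  On a horizontal segment towards the imaginary axis the real part of the square does not grow.
\<close>
lemma gauss_primitive_horizontal:
  assumes G: "\<And>w. (G has_field_derivative exp (w\<^sup>2)) (at w)"
  shows "cmod (G w - G (\<i> * of_real (Im w))) \<le> exp (Re (w\<^sup>2)) * cmod w"
proof -
  define p q where "p = Re w" and "q = Im w"
  have w: "w = of_real p + \<i> * of_real q" by (simp add: p_def q_def complex_eq_iff)
  have "cmod (G w - G (\<i> * of_real q)) \<le> exp (Re (w\<^sup>2)) * cmod (w - \<i> * of_real q)"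
  proof (rule field_differentiable_bound[of "closed_segment (\<i> * of_real q) w" G "\<lambda>w. exp (w\<^sup>2)"])
    fix x assume "x \<in> closed_segment (\<i> * of_real q) w"
    then obtain t where t: "0 \<le> t" "t \<le> 1" "x = (1 - t) *\<^sub>R (\<i> * of_real q) + t *\<^sub>R w"
      by (auto simp: closed_segment_def)
    show "(G has_field_derivative exp (x\<^sup>2)) (at x within closed_segment (\<i> * of_real q) w)"
      by (rule has_field_derivative_at_within[OF G])
    have "x = of_real (t * p) + \<i> * of_real q"
      unfolding t(3) w scaleR_conv_of_real by (simp add: algebra_simps)
    then have "Re (x\<^sup>2) = (t * p)\<^sup>2 - q\<^sup>2" by (simp add: power2_eq_square)
    also have "\<dots> \<le> p\<^sup>2 - q\<^sup>2" using t mult_right_mono[of "t\<^sup>2" 1 "p\<^sup>2"]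
      by (simp add: power_mult_distrib power_le_one)
    also have "\<dots> = Re (w\<^sup>2)" by (simp add: w power2_eq_square)
    finally show "cmod (exp (x\<^sup>2)) \<le> exp (Re (w\<^sup>2))" by simp
  qed auto
  also have "cmod (w - \<i> * of_real q) = \<bar>p\<bar>" by (simp add: w)
  also have "\<bar>p\<bar> \<le> cmod w" unfolding p_def by (rule abs_Re_le_cmod)
  finally show ?thesis by (simp add: q_def mult_left_mono)
qed

text \<open>
  The difference is \<open>\<i>\<close> times the integral of \<open>exp (- s^2)\<close> over \<open>- q \<le> s \<le> q\<close>.
\<close>
lemma gauss_primitive_lower:
  assumes G: "\<And>w. (G has_field_derivative exp (w\<^sup>2)) (at w)" and q: "q \<ge> 1"
  shows "2 / 3 \<le> cmod (G (\<i> * of_real q) - G (\<i> * of_real (-q)))"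
proof -
  define g where "g s = Im (G (\<i> * of_real s))" for s :: real
  have g: "(g has_real_derivative exp (- s\<^sup>2)) (at s)" for s
  proof -
    have "((\<lambda>s. \<i> * complex_of_real s) has_vector_derivative \<i>) (at s)"
      by (auto intro!: derivative_eq_intros)
    from field_vector_diff_chain_at[OF this G]
    have "((\<lambda>s. G (\<i> * complex_of_real s)) has_vector_derivative \<i> * exp ((\<i> * of_real s)\<^sup>2)) (at s)"
      by (simp add: o_def)
    from bounded_linear.has_vector_derivative[OF bounded_linear_Im this]
    have "(g has_vector_derivative Im (\<i> * exp ((\<i> * of_real s)\<^sup>2))) (at s)"
      by (simp add: g_def[abs_def])
    also have "Im (\<i> * exp ((\<i> * of_real s)\<^sup>2)) = exp (- s\<^sup>2)"
      by (simp add: power_mult_distrib Re_exp)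
    finally show ?thesis using has_real_derivative_iff_has_vector_derivative by blast
  qed
  have mono: "g x \<le> g y" if "x \<le> y" for x y
    by (rule DERIV_nonneg_imp_nondecreasing[OF that]) (rule exI, rule conjI[OF g], simp)
  have "g (-1) - (-1) / 3 \<le> g 1 - 1 / 3"
  proof (rule DERIV_nonneg_imp_nondecreasing[of "-1" 1 "\<lambda>s. g s - s / 3"])
    fix s :: real assume s: "-1 \<le> s" "s \<le> 1"
    have "exp (1::real) \<le> 3" by (rule exp_le)
    then have "1 / 3 \<le> exp (-1::real)" by (simp add: exp_minus field_simps)
    also have "\<dots> \<le> exp (- s\<^sup>2)" using s by (simp add: abs_square_le_1)
    finally have "0 \<le> exp (- s\<^sup>2) - 1 / 3" by simp
    moreover have "((\<lambda>s. g s - s / 3) has_real_derivative exp (- s\<^sup>2) - 1 / 3) (at s)"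
      by (auto intro!: derivative_eq_intros g)
    ultimately show "\<exists>y. ((\<lambda>s. g s - s / 3) has_real_derivative y) (at s) \<and> 0 \<le> y" by blast
  qed simp
  then have "2 / 3 \<le> g 1 - g (-1)" by simp
  also have "\<dots> \<le> g q - g (-q)" using mono[of 1 q] mono[of "-q" "-1"] q by simp
  also have "\<dots> = Im (G (\<i> * of_real q) - G (\<i> * of_real (-q)))" by (simp add: g_def)
  also have "\<dots> \<le> cmod (G (\<i> * of_real q) - G (\<i> * of_real (-q)))"
    using abs_Im_le_cmod by (rule order_trans[OF abs_ge_self])
  finally show ?thesis .
qed

text \<open>
  The integral of \<open>z powr (k / 2) * exp (X * (z + 1 / z))\<close> over the segment from \<open>1 - \<i>\<close> to
  \<open>1 + \<i>\<close>, parametrized by \<open>t = Im z\<close> (so without the factor \<open>\<i>\<close> of the contour integral).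
\<close>
definition saddle_integral :: "int \<Rightarrow> real \<Rightarrow> complex" where
  "saddle_integral k X =
     integral {-1..1} (\<lambda>t. csqrt (1 + \<i> * of_real t) powi k * saddle_exp X (1 + \<i> * of_real t))"

lemma saddle_integral_has_integral:
  "((\<lambda>t. csqrt (1 + \<i> * of_real t) powi k * saddle_exp X (1 + \<i> * of_real t)) has_integral saddle_integral k X) {-1..1}"
proof -
  have "1 + \<i> * complex_of_real t \<noteq> 0" for t by (simp add: complex_eq_iff)
  then have r0: "csqrt (1 + \<i> * of_real t) \<noteq> 0" for t using csqrt_eq_0 by blast
  show ?thesis unfolding saddle_integral_def
    by (intro integrable_integral integrable_continuous_real continuous_intros) (use r0 in auto)
qed

lemma saddle_exp_derivative:
  assumes "z \<noteq> 0"
  shows "(saddle_exp X has_field_derivative of_real X * (1 - 1 / z\<^sup>2) * saddle_exp X z) (at z)"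
  unfolding saddle_exp_def[abs_def] using assms
  by (auto intro!: derivative_eq_intros simp: power2_eq_square)

lemma has_integral_vertical_unit:
  assumes "\<And>z. Re z = 1 \<Longrightarrow> (H has_field_derivative h z) (at z)"
  shows "((\<lambda>t. h (1 + \<i> * of_real t)) has_integral (H (1 + \<i>) - H (1 - \<i>)) / \<i>) {-1..1::real}"
  using has_integral_vertical[of "-1" 1 H h 1] assms by simp

lemma csqrt_on_line_one:
  assumes "Re z = 1"
  shows "z \<notin> \<real>\<^sub>\<le>\<^sub>0" "z \<noteq> 0" "csqrt z \<noteq> 0" "(csqrt z)\<^sup>2 = z"
  using assms by (auto simp: complex_nonpos_Reals_iff)

text \<open>
  Integration of the derivative of \<open>sqrt z * exp (X * (z + 1 / z))\<close>.
\<close>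
lemma saddle_recurrence_1:
  "saddle_integral (-1) X / 2 + X * saddle_integral 1 X - X * saddle_integral (-3) X =
   (csqrt (1 + \<i>) * saddle_exp X (1 + \<i>) - csqrt (1 - \<i>) * saddle_exp X (1 - \<i>)) / \<i>"
proof (rule has_integral_unique)
  define h where "h z = csqrt z powi (-1) * saddle_exp X z / 2 + of_real X * (csqrt z powi 1 * saddle_exp X z)
      - of_real X * (csqrt z powi (-3) * saddle_exp X z)" for z
  show "((\<lambda>t. h (1 + \<i> * of_real t)) has_integral (saddle_integral (-1) X / 2 + X * saddle_integral 1 X - X * saddle_integral (-3) X)) {-1..1}"
    unfolding h_def
    by (intro has_integral_diff has_integral_add has_integral_mult_right has_integral_divide
        saddle_integral_has_integral)
  show "((\<lambda>t. h (1 + \<i> * of_real t)) has_integral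
     (csqrt (1 + \<i>) * saddle_exp X (1 + \<i>) - csqrt (1 - \<i>) * saddle_exp X (1 - \<i>)) / \<i>) {-1..1}"
  proof (rule has_integral_vertical_unit)
    fix z :: complex assume "Re z = 1"
    note z = csqrt_on_line_one[OF this]
    have "((\<lambda>z. csqrt z * saddle_exp X z) has_field_derivative
       inverse (2 * csqrt z) * saddle_exp X z + of_real X * (1 - 1 / z\<^sup>2) * saddle_exp X z * csqrt z) (at z)"
      by (rule DERIV_mult[OF has_field_derivative_csqrt saddle_exp_derivative]) (use z in auto)
    also have "inverse (2 * csqrt z) * saddle_exp X z + of_real X * (1 - 1 / z\<^sup>2) * saddle_exp X z * csqrt z = h z"
    proof -
      have "inverse (2 * r) * s + x * (1 - 1 / (r\<^sup>2)\<^sup>2) * s * r = inverse r * s / 2 + x * (r * s) - x * (inverse r ^ 3 * s)"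
        if "r \<noteq> 0" for r s x :: complex
        using that by (simp add: field_simps power2_eq_square power3_eq_cube)
      from this[OF z(3)] show ?thesis by (simp add: h_def z(4) power_int_minus power_inverse)
    qed
    finally show "((\<lambda>z. csqrt z * saddle_exp X z) has_field_derivative h z) (at z)" .
  qed
qed

text \<open>
  Integration of the derivative of \<open>z * sqrt z * exp (X * (z + 1 / z))\<close>.
\<close>
lemma saddle_recurrence_2:
  "3 / 2 * saddle_integral 1 X + X * saddle_integral 3 X - X * saddle_integral (-1) X =
   ((1 + \<i>) * csqrt (1 + \<i>) * saddle_exp X (1 + \<i>) - (1 - \<i>) * csqrt (1 - \<i>) * saddle_exp X (1 - \<i>)) / \<i>"
proof (rule has_integral_unique)
  define h where "h z = 3 / 2 * (csqrt z powi 1 * saddle_exp X z) + of_real X * (csqrt z powi 3 * saddle_exp X z)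
      - of_real X * (csqrt z powi (-1) * saddle_exp X z)" for z
  show "((\<lambda>t. h (1 + \<i> * of_real t)) has_integral (3 / 2 * saddle_integral 1 X + X * saddle_integral 3 X - X * saddle_integral (-1) X)) {-1..1}"
    unfolding h_def
    by (intro has_integral_diff has_integral_add has_integral_mult_right saddle_integral_has_integral)
  show "((\<lambda>t. h (1 + \<i> * of_real t)) has_integral
     ((1 + \<i>) * csqrt (1 + \<i>) * saddle_exp X (1 + \<i>) - (1 - \<i>) * csqrt (1 - \<i>) * saddle_exp X (1 - \<i>)) / \<i>) {-1..1}"
  proof (rule has_integral_vertical_unit)
    fix z :: complex assume "Re z = 1"
    note z = csqrt_on_line_one[OF this]
    have "((\<lambda>z. z * csqrt z * saddle_exp X z) has_field_derivative
       (1 * csqrt z + inverse (2 * csqrt z) * z) * saddle_exp X z + of_real X * (1 - 1 / z\<^sup>2) * saddle_exp X z * (z * csqrt z)) (at z)"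
      by (rule DERIV_mult[OF DERIV_mult[OF DERIV_ident has_field_derivative_csqrt] saddle_exp_derivative]) (use z in auto)
    also have "(1 * csqrt z + inverse (2 * csqrt z) * z) * saddle_exp X z + of_real X * (1 - 1 / z\<^sup>2) * saddle_exp X z * (z * csqrt z) = h z"
    proof -
      have "(1 * r + inverse (2 * r) * r\<^sup>2) * s + x * (1 - 1 / (r\<^sup>2)\<^sup>2) * s * (r\<^sup>2 * r) = 3 / 2 * (r * s) + x * (r ^ 3 * s) - x * (inverse r * s)"
        if "r \<noteq> 0" for r s x :: complex
        using that by (simp add: field_simps power2_eq_square power3_eq_cube)
      from this[OF z(3)] show ?thesis by (simp add: h_def z(4) power_int_minus)
    qed
    finally show "((\<lambda>z. z * csqrt z * saddle_exp X z) has_field_derivative h z) (at z)" .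
  qed
qed

text \<open>
  The substitution \<open>w = sqrt z + \<sigma> / sqrt z\<close>: as \<open>\<sigma>^2 = 1\<close>, the exponent is
  \<open>X * w^2 - 2 * \<sigma> * X\<close>, and \<open>G\<close> is a primitive of \<open>exp (w^2)\<close>.  The sign \<open>\<sigma> = 1\<close> shows that two of
  the integrals almost agree, the sign \<open>\<sigma> = -1\<close> evaluates their sum.
\<close>
lemma saddle_substitution:
  assumes G: "\<And>w. (G has_field_derivative exp (w\<^sup>2)) (at w)" and X: "X > 0" and s: "\<sigma> = 1 \<or> \<sigma> = (-1::complex)"
  defines "v \<equiv> \<lambda>z. of_real (sqrt X) * (csqrt z + \<sigma> / csqrt z)"
  shows "saddle_integral (-1) X - \<sigma> * saddle_integral (-3) X =
     2 / (\<i> * of_real (sqrt X)) * exp (- 2 * \<sigma> * of_real X) * (G (v (1 + \<i>)) - G (v (1 - \<i>)))"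
proof (rule has_integral_unique)
  define h where "h z = csqrt z powi (-1) * saddle_exp X z - \<sigma> * (csqrt z powi (-3) * saddle_exp X z)" for z
  define c where "c = 2 / of_real (sqrt X) * exp (- 2 * \<sigma> * of_real X)"
  show "((\<lambda>t. h (1 + \<i> * of_real t)) has_integral (saddle_integral (-1) X - \<sigma> * saddle_integral (-3) X)) {-1..1}"
    unfolding h_def
    by (intro has_integral_diff has_integral_mult_right saddle_integral_has_integral)
  have sX: "complex_of_real (sqrt X) \<noteq> 0" "(complex_of_real (sqrt X))\<^sup>2 = of_real X"
    using X by (simp_all flip: of_real_power)
  have "((\<lambda>t. h (1 + \<i> * of_real t)) has_integral
     (c * G (v (1 + \<i>)) - c * G (v (1 - \<i>))) / \<i>) {-1..1}"
  proof (rule has_integral_vertical_unit)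
    fix z :: complex assume "Re z = 1"
    note z = csqrt_on_line_one[OF this]
    define r where "r = csqrt z"
    have r: "r \<noteq> 0" "r\<^sup>2 = z" using z by (auto simp: r_def)
    define v' where "v' = of_real (sqrt X) * (inverse (2 * r) + \<sigma> * (- (inverse r * inverse (2 * r) * inverse r)))"
    have dr: "(csqrt has_field_derivative inverse (2 * r)) (at z)"
      unfolding r_def by (rule has_field_derivative_csqrt) (use z in auto)
    have "(v has_field_derivative v') (at z)"
      unfolding v_def v'_def divide_inverse
      by (intro DERIV_cmult DERIV_add dr DERIV_inverse'[OF dr, folded r_def, OF r(1)])
    then have "((\<lambda>z. c * G (v z)) has_field_derivative c * (exp ((v z)\<^sup>2) * v')) (at z)"
      by (intro DERIV_cmult DERIV_chain2[OF G])
    also have "c * (exp ((v z)\<^sup>2) * v') = h z"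
    proof -
      have "(v z)\<^sup>2 = of_real X * (z + 1 / z) + 2 * \<sigma> * of_real X"
      proof -
        have "(r + \<sigma> / r)\<^sup>2 = r\<^sup>2 + 1 / r\<^sup>2 + 2 * \<sigma>"
          using r(1) s by (auto simp: power2_eq_square field_simps)
        then show ?thesis unfolding v_def r_def[symmetric] power_mult_distrib sX(2) r(2)
          by (simp add: algebra_simps)
      qed
      then have "exp (- 2 * \<sigma> * of_real X) * exp ((v z)\<^sup>2) = saddle_exp X z"
        by (simp add: saddle_exp_def exp_add[symmetric])
      then have "c * (exp ((v z)\<^sup>2) * v') = 2 / of_real (sqrt X) * v' * saddle_exp X z"
        by (simp add: c_def mult_ac)
      also have "2 / of_real (sqrt X) * v' = inverse r - \<sigma> * inverse r ^ 3"
        using sX(1) r(1) unfolding v'_def by (simp add: field_simps power3_eq_cube)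
      finally show ?thesis by (simp add: h_def r_def power_int_minus power_inverse algebra_simps)
    qed
    finally show "((\<lambda>z. c * G (v z)) has_field_derivative h z) (at z)" .
  qed
  also have "(c * G (v (1 + \<i>)) - c * G (v (1 - \<i>))) / \<i> =
     2 / (\<i> * of_real (sqrt X)) * exp (- 2 * \<sigma> * of_real X) * (G (v (1 + \<i>)) - G (v (1 - \<i>)))"
    using sX(1) by (simp add: c_def field_simps)
  finally show "((\<lambda>t. h (1 + \<i> * of_real t)) has_integral
     2 / (\<i> * of_real (sqrt X)) * exp (- 2 * \<sigma> * of_real X) * (G (v (1 + \<i>)) - G (v (1 - \<i>)))) {-1..1}" .
qed

lemma norm_corner: "cmod (1 + \<i>) = sqrt 2" "cmod (1 - \<i>) = sqrt 2"
  by (simp_all add: cmod_def)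

lemma norm_csqrt_corner:
  "cmod (csqrt (1 + \<i>)) \<le> 2" "cmod (csqrt (1 - \<i>)) \<le> 2"
  "1 \<le> cmod (csqrt (1 + \<i>))" "1 \<le> cmod (csqrt (1 - \<i>))"
  using norm_csqrt_vertical[of 1] norm_csqrt_vertical[of "-1"] by auto

lemma norm_diff_div_i_le: "cmod ((a - b) / \<i>) \<le> cmod a + cmod b"
  using norm_triangle_ineq4[of a b] by (simp only: norm_divide norm_ii div_by_1)

lemma saddle_recurrence_1_bound:
  "cmod (saddle_integral (-1) X / 2 + X * saddle_integral 1 X - X * saddle_integral (-3) X) \<le> 4 * exp (3/2 * X)"
proof -
  have "cmod (saddle_integral (-1) X / 2 + X * saddle_integral 1 X - X * saddle_integral (-3) X)
     \<le> cmod (csqrt (1 + \<i>) * saddle_exp X (1 + \<i>)) + cmod (csqrt (1 - \<i>) * saddle_exp X (1 - \<i>))"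
    unfolding saddle_recurrence_1 by (rule norm_diff_div_i_le)
  also have "\<dots> \<le> 2 * exp (3/2 * X) + 2 * exp (3/2 * X)"
    unfolding norm_mult norm_saddle_exp_end by (intro add_mono mult_right_mono norm_csqrt_corner) auto
  finally show ?thesis by simp
qed

lemma saddle_recurrence_2_bound:
  "cmod (3 / 2 * saddle_integral 1 X + X * saddle_integral 3 X - X * saddle_integral (-1) X) \<le> 8 * exp (3/2 * X)"
proof -
  have s2: "sqrt 2 \<le> 2" by (rule real_le_lsqrt) auto
  have "cmod (3 / 2 * saddle_integral 1 X + X * saddle_integral 3 X - X * saddle_integral (-1) X)
     \<le> cmod ((1 + \<i>) * csqrt (1 + \<i>) * saddle_exp X (1 + \<i>)) + cmod ((1 - \<i>) * csqrt (1 - \<i>) * saddle_exp X (1 - \<i>))"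
    unfolding saddle_recurrence_2 by (rule norm_diff_div_i_le)
  also have "\<dots> \<le> 2 * 2 * exp (3/2 * X) + 2 * 2 * exp (3/2 * X)"
    unfolding norm_mult norm_saddle_exp_end norm_corner
    by (intro add_mono mult_right_mono mult_mono norm_csqrt_corner s2) auto
  finally show ?thesis by simp
qed

lemma saddle_corner_sq:
  assumes "X \<ge> 0" "\<sigma> = 1 \<or> \<sigma> = (-1::complex)" "w = 1 + \<i> \<or> w = 1 - \<i>"
  defines "v \<equiv> of_real (sqrt X) * (csqrt w + \<sigma> / csqrt w)"
  shows "Re (v\<^sup>2) = X * (3 / 2 + 2 * Re \<sigma>)" "cmod v \<le> 3 * sqrt X"
proof -
  define r where "r = csqrt w"
  have w: "w \<noteq> 0" "Re (w + 1 / w) = 3 / 2" using assms(3) by (auto simp: complex_eq_iff Re_divide)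
  have r: "r \<noteq> 0" "r\<^sup>2 = w" "1 \<le> cmod r" "cmod r \<le> 2"
    using w norm_csqrt_corner assms(3) by (auto simp: r_def)
  have "(r + \<sigma> / r)\<^sup>2 = r\<^sup>2 + 1 / r\<^sup>2 + 2 * \<sigma>"
    using r(1) assms(2) by (auto simp: power2_eq_square field_simps)
  then have "v\<^sup>2 = of_real X * (w + 1 / w + 2 * \<sigma>)"
    using assms(1) unfolding v_def r_def[symmetric] power_mult_distrib r(2)
    by (simp flip: of_real_power)
  then have "Re (v\<^sup>2) = X * Re (w + 1 / w + 2 * \<sigma>)"
    by (simp only: times_complex.simps Re_complex_of_real Im_complex_of_real mult_zero_left diff_zero)
  also have "Re (w + 1 / w + 2 * \<sigma>) = 3 / 2 + 2 * Re \<sigma>"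
    unfolding plus_complex.simps(1)[of "w + 1 / w"] w(2) using assms(2) by auto
  finally show "Re (v\<^sup>2) = X * (3 / 2 + 2 * Re \<sigma>)" .
  have "cmod (r + \<sigma> / r) \<le> cmod r + cmod (\<sigma> / r)" by (rule norm_triangle_ineq)
  also have "cmod (\<sigma> / r) \<le> 1" using assms(2) r(3) by (auto simp: norm_divide divide_le_eq_1)
  also have "cmod r \<le> 2" by (rule r)
  finally show "cmod v \<le> 3 * sqrt X"
    using assms(1) mult_left_mono[of "cmod (r + \<sigma> / r)" 3 "sqrt X"]
    unfolding v_def r_def[symmetric] norm_mult by (simp add: mult.commute)
qed

text \<open>
  The value \<open>exp (3/2 * X)\<close> is the size of the exponential at the end points, much smaller
  than the value \<open>exp (2 * X)\<close> at the saddle point.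
\<close>
lemma saddle_difference_bound:
  assumes "X > 0"
  shows "cmod (saddle_integral (-1) X - saddle_integral (-3) X) \<le> 12 * exp (3/2 * X)"
proof -
  obtain G :: "complex \<Rightarrow> complex" where G: "\<And>w. (G has_field_derivative exp (w\<^sup>2)) (at w)"
    using ex_gauss_primitive by blast
  define v where "v = (\<lambda>z. of_real (sqrt X) * (csqrt z + 1 / csqrt z))"
  have b: "cmod (G (v w) - G 0) \<le> exp (7/2 * X) * (3 * sqrt X)" if "w = 1 + \<i> \<or> w = 1 - \<i>" for w
  proof -
    have v: "Re ((v w)\<^sup>2) = 7/2 * X" "cmod (v w) \<le> 3 * sqrt X"
      using saddle_corner_sq[of X 1 w] that assms by (auto simp: v_def)
    have "cmod (G (v w) - G 0) \<le> exp (7/2 * X) * cmod (v w)"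
      using gauss_primitive_upper[OF G, of "v w"] v(1) assms by simp
    also have "\<dots> \<le> exp (7/2 * X) * (3 * sqrt X)" by (intro mult_left_mono v) auto
    finally show ?thesis .
  qed
  have "cmod (G (v (1 + \<i>)) - G (v (1 - \<i>))) \<le> cmod (G (v (1 + \<i>)) - G 0) + cmod (G (v (1 - \<i>)) - G 0)"
    using norm_triangle_ineq4[of "G (v (1 + \<i>)) - G 0" "G (v (1 - \<i>)) - G 0"] by simp
  also have "\<dots> \<le> exp (7/2 * X) * (3 * sqrt X) + exp (7/2 * X) * (3 * sqrt X)"
    by (intro add_mono b) auto
  finally have d: "cmod (G (v (1 + \<i>)) - G (v (1 - \<i>))) \<le> 6 * sqrt X * exp (7/2 * X)" by simp
  have "cmod (saddle_integral (-1) X - saddle_integral (-3) X)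
    = 2 / sqrt X * exp (- 2 * X) * cmod (G (v (1 + \<i>)) - G (v (1 - \<i>)))"
    using saddle_substitution[OF G assms, of 1] assms by (simp add: v_def norm_mult norm_divide)
  also have "\<dots> \<le> 2 / sqrt X * exp (- 2 * X) * (6 * sqrt X * exp (7/2 * X))"
    using assms by (intro mult_left_mono d) auto
  also have "\<dots> = 12 * (exp (- 2 * X) * exp (7/2 * X))" using assms by simp
  also have "exp (- 2 * X) * exp (7/2 * X) = exp (3/2 * X)" by (simp add: exp_add[symmetric])
  finally show ?thesis .
qed

text \<open>
  In the variable \<open>sqrt z - 1 / sqrt z\<close> the two end points are complex conjugate, and the difference
  of \<open>G\<close> between them is compared with the Gaussian integral along the imaginary axis.
\<close>
lemma saddle_sum_lower:
  assumes "X \<ge> 2"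
  shows "2 / sqrt X * exp (2 * X) * (2 / 3 - 6 * sqrt X * exp (- X / 2))
     \<le> cmod (saddle_integral (-1) X + saddle_integral (-3) X)"
proof -
  obtain G :: "complex \<Rightarrow> complex" where G: "\<And>w. (G has_field_derivative exp (w\<^sup>2)) (at w)"
    using ex_gauss_primitive by blast
  define v where "v = (\<lambda>z. of_real (sqrt X) * (csqrt z + (-1) / csqrt z))"
  have v: "Re ((v w)\<^sup>2) = - X / 2" "cmod (v w) \<le> 3 * sqrt X" if "w = 1 + \<i> \<or> w = 1 - \<i>" for w
    using saddle_corner_sq[of X "-1" w] that assms by (auto simp: v_def)
  have b: "cmod (G (v w) - G (\<i> * of_real (Im (v w)))) \<le> exp (- X / 2) * (3 * sqrt X)"
    if w: "w = 1 + \<i> \<or> w = 1 - \<i>" for w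
    using order_trans[OF gauss_primitive_horizontal[OF G, of "v w"] mult_left_mono[OF v(2)[OF w]]] v(1)[OF w]
    by simp
  define q where "q = Im (v (1 + \<i>))"
  have "cnj (csqrt (1 + \<i>)) = csqrt (1 - \<i>)"
    using cnj_csqrt[of "1 + \<i>"] by (simp add: complex_nonpos_Reals_iff)
  then have "v (1 - \<i>) = cnj (v (1 + \<i>))" by (simp add: v_def)
  then have q': "Im (v (1 - \<i>)) = - q" by (simp add: q_def)
  have "q\<^sup>2 = (Re (v (1 + \<i>)))\<^sup>2 + X / 2"
    using v(1)[of "1 + \<i>"] by (simp add: q_def power2_eq_square)
  then have "q\<^sup>2 \<ge> 1" using assms zero_le_power2[of "Re (v (1 + \<i>))"] by linarith
  then have "1 \<le> \<bar>q\<bar>" by (simp add: abs_le_square_iff[of 1 q, simplified])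
  then have "2 / 3 \<le> cmod (G (\<i> * of_real q) - G (\<i> * of_real (-q)))"
    using gauss_primitive_lower[OF G, of q] gauss_primitive_lower[OF G, of "-q"]
    by (cases "q \<ge> 0") (auto simp: norm_minus_commute)
  also have "\<dots> \<le> cmod (G (v (1 + \<i>)) - G (v (1 - \<i>)))
     + cmod (G (v (1 + \<i>)) - G (\<i> * of_real q)) + cmod (G (v (1 - \<i>)) - G (\<i> * of_real (-q)))"
  proof -
    have tri: "cmod (a' - b') \<le> cmod (a - b) + cmod (a - a') + cmod (b - b')" for a b a' b'
    proof -
      have "cmod (a' - b') \<le> cmod (a' - b) + cmod (b - b')"
        using norm_triangle_ineq[of "a' - b" "b - b'"] by simp
      also have "cmod (a' - b) \<le> cmod (a - b) + cmod (a - a')"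
        using norm_triangle_ineq4[of "a - b" "a - a'"] by simp
      finally show ?thesis by simp
    qed
    show ?thesis by (rule tri)
  qed
  also have "\<dots> \<le> cmod (G (v (1 + \<i>)) - G (v (1 - \<i>))) + exp (- X / 2) * (3 * sqrt X) + exp (- X / 2) * (3 * sqrt X)"
    using b[of "1 + \<i>"] b[of "1 - \<i>"] unfolding q' q_def[symmetric] by (intro add_mono order_refl) auto
  finally have lower: "2 / 3 - 6 * sqrt X * exp (- X / 2) \<le> cmod (G (v (1 + \<i>)) - G (v (1 - \<i>)))"
    by (simp add: algebra_simps)
  have "cmod (saddle_integral (-1) X + saddle_integral (-3) X)
    = 2 / sqrt X * exp (2 * X) * cmod (G (v (1 + \<i>)) - G (v (1 - \<i>)))"
    using saddle_substitution[OF G, of X "-1"] assms by (simp add: v_def norm_mult norm_divide)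
  moreover have "2 / sqrt X * exp (2 * X) * (2 / 3 - 6 * sqrt X * exp (- X / 2))
     \<le> 2 / sqrt X * exp (2 * X) * cmod (G (v (1 + \<i>)) - G (v (1 - \<i>)))"
    using assms by (intro mult_left_mono lower) auto
  ultimately show ?thesis by simp
qed

lemma saddle_integral_minus1_upper:
  assumes "X > 0"
  shows "cmod (saddle_integral (-1) X) \<le> 5 * exp (2 * X) / sqrt X"
  using integral_saddle_bounds(3)[OF assms] by (simp add: saddle_integral_def power_int_minus divide_inverse mult.commute)

text \<open>
  The order of magnitude \<open>exp (2 * X) / sqrt X\<close> of the denominator, from below.
\<close>
lemma saddle_integral_lower:
  "eventually (\<lambda>X. 1 / 4 * exp (2 * X) / sqrt X \<le> cmod (saddle_integral 1 X)) at_top"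
proof -
  have 1: "eventually (\<lambda>X::real. exp (2 * X) / sqrt X \<le> 2 / sqrt X * exp (2 * X) * (2 / 3 - 6 * sqrt X * exp (- X / 2))) at_top"
    by real_asymp
  have 2: "eventually (\<lambda>X::real. 10 * exp (3/2 * X) + 5 * exp (2 * X) / sqrt X / (2 * X) \<le> 1 / 4 * exp (2 * X) / sqrt X) at_top"
    by real_asymp
  show ?thesis using 1 2 eventually_ge_at_top[of 2]
  proof eventually_elim
    case (elim X)
    define a b d where "a = saddle_integral (-1) X" and "b = saddle_integral 1 X" and "d = saddle_integral (-3) X"
    define e m where "e = exp (3/2 * X)" and "m = exp (2 * X) / sqrt X"
    have ad: "cmod (a - d) \<le> 12 * e"
      using saddle_difference_bound[of X] elim by (simp add: a_def d_def e_def)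
    have sum: "m \<le> cmod (a + d)"
      using saddle_sum_lower[of X] elim by (simp add: a_def d_def m_def)
    have "cmod (a + d) \<le> cmod (2 * d) + cmod (a - d)"
      using norm_triangle_ineq[of "2 * d" "a - d"] by (simp add: add.commute)
    then have d: "m / 2 - 6 * e \<le> cmod d" using ad sum by (simp add: norm_mult)
    have a: "cmod a \<le> 5 * m" using saddle_integral_minus1_upper[of X] elim by (simp add: a_def m_def)
    define \<rho> where "\<rho> = a / 2 + X * b - X * d"
    have \<rho>: "cmod \<rho> \<le> 4 * e"
      using saddle_recurrence_1_bound[of X] by (simp add: \<rho>_def a_def b_def d_def e_def)
    have "d = b + (a / (2 * X) - \<rho> / X)" using elim by (simp add: \<rho>_def field_simps)
    then have "cmod d \<le> cmod b + (cmod (a / (2 * X)) + cmod (\<rho> / X))"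
      by (metis norm_triangle_le norm_triangle_ineq4 add_left_mono)
    moreover have "cmod (a / (2 * X)) \<le> 5 * m / (2 * X)"
      using a elim by (simp add: norm_divide norm_mult divide_right_mono)
    moreover have "cmod (\<rho> / X) \<le> 4 * e"
    proof -
      have "cmod (\<rho> / X) = cmod \<rho> / X" using elim by (simp add: norm_divide)
      also have "\<dots> \<le> cmod \<rho> / 1" using elim by (intro divide_left_mono) auto
      finally show ?thesis using \<rho> by simp
    qed
    ultimately have "m / 2 - (10 * e + 5 * m / (2 * X)) \<le> cmod b" using d by linarith
    moreover have "10 * e + 5 * m / (2 * X) \<le> m / 4" using elim(2) by (simp add: e_def m_def)
    ultimately have "m / 4 \<le> cmod b" by linarith
    then show ?case by (simp add: b_def m_def)
  qed
qed

text \<open>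
  The weighted integral of \<open>z - 1\<close> equals \<open>- 1 / X\<close> times the weighted integral of \<open>1\<close>, with an error
  that is \<open>O(1 / X^2)\<close> times the latter.  All four integrals are expressed through
  \<open>a = saddle_integral (-1) X\<close> and \<open>\<delta>\<close>, \<open>\<rho>\<close>, \<open>\<rho>'\<close>, which are exponentially smaller than
  \<open>exp (2 * X)\<close>.
\<close>
lemma saddle_integral_drift:
  "eventually (\<lambda>X. cmod (saddle_integral 3 X - saddle_integral 1 X + saddle_integral 1 X / X)
      \<le> 2 * exp (2 * X) / (X\<^sup>2 * sqrt X)) at_top"
proof -
  have "eventually (\<lambda>X::real. 5 * exp (2 * X) / sqrt X / (4 * X\<^sup>2) + 40 * exp (3/2 * X) \<le> 2 * exp (2 * X) / (X\<^sup>2 * sqrt X)) at_top"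
    by real_asymp
  then show ?thesis using eventually_ge_at_top[of 1]
  proof eventually_elim
    case (elim X)
    define a b d k where "a = saddle_integral (-1) X" and "b = saddle_integral 1 X"
      and "d = saddle_integral (-3) X" and "k = saddle_integral 3 X"
    define e where "e = exp (3/2 * X)"
    define \<delta> \<rho> \<rho>' where "\<delta> = a - d" and "\<rho> = a / 2 + X * b - X * d" and "\<rho>' = 3 / 2 * b + X * k - X * a"
    have \<delta>: "cmod \<delta> \<le> 12 * e"
      using saddle_difference_bound[of X] elim by (simp add: a_def d_def e_def \<delta>_def)
    have \<rho>: "cmod \<rho> \<le> 4 * e"
      using saddle_recurrence_1_bound[of X] by (simp add: \<rho>_def a_def b_def d_def e_def)
    have \<rho>': "cmod \<rho>' \<le> 8 * e"
      using saddle_recurrence_2_bound[of X] by (simp add: \<rho>'_def a_def b_def k_def e_def)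
    have e0: "e \<ge> 0" by (simp add: e_def)
    have a: "cmod a \<le> 5 * exp (2 * X) / sqrt X" using saddle_integral_minus1_upper[of X] elim by (simp add: a_def)
    have X0: "complex_of_real X \<noteq> 0" using elim by simp
    have d: "d = a - \<delta>" by (simp add: \<delta>_def)
    have b: "b = a - \<delta> - a / (2 * X) + \<rho> / X" using X0 by (simp add: \<rho>_def d field_simps)
    have k: "k = a - 3 / 2 * b / X + \<rho>' / X" using X0 by (simp add: \<rho>'_def field_simps)
    have "k - b + b / X = a - (1 + 1 / (2 * X)) * b + \<rho>' / X"
      using X0 by (simp add: k field_simps)
    also have "\<dots> = a / (4 * X\<^sup>2) + ((1 + 1 / (2 * X)) * (\<delta> - \<rho> / X) + \<rho>' / X)"
      using X0 by (subst b) (simp add: field_simps power2_eq_square)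
    finally have "cmod (k - b + b / X) \<le> cmod (a / (4 * X\<^sup>2)) + cmod ((1 + 1 / (2 * X)) * (\<delta> - \<rho> / X) + \<rho>' / X)"
      by (simp only: norm_triangle_ineq)
    also have "cmod (a / (4 * X\<^sup>2)) \<le> 5 * exp (2 * X) / sqrt X / (4 * X\<^sup>2)"
      using divide_right_mono[OF a, of "4 * X\<^sup>2"] by (simp add: norm_divide norm_mult norm_power)
    also have "cmod ((1 + 1 / (2 * X)) * (\<delta> - \<rho> / X) + \<rho>' / X) \<le> 2 * (12 * e + 4 * e) + 8 * e"
    proof -
      have dX: "cmod (r / X) \<le> c" if "cmod r \<le> c" for r c
      proof -
        have "cmod (r / X) = cmod r / X" using elim by (simp add: norm_divide)
        also have "\<dots> \<le> cmod r / 1" using elim by (intro divide_left_mono) auto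
        finally show ?thesis using that by simp
      qed
      have "cmod (complex_of_real (1 + 1 / (2 * X))) = 1 + 1 / (2 * X)"
        using elim unfolding norm_of_real by simp
      also have "\<dots> \<le> 2" using elim by (simp add: divide_le_eq)
      finally have f: "cmod (1 + 1 / (2 * complex_of_real X)) \<le> 2" by simp
      have "cmod (\<delta> - \<rho> / X) \<le> 12 * e + 4 * e"
        using norm_triangle_ineq4[of \<delta> "\<rho> / X"] \<delta> dX[OF \<rho>] by linarith
      then have "cmod ((1 + 1 / (2 * X)) * (\<delta> - \<rho> / X)) \<le> 2 * (12 * e + 4 * e)"
        unfolding norm_mult using f e0 by (intro mult_mono) auto
      then show ?thesis using norm_triangle_ineq[of "(1 + 1 / (2 * X)) * (\<delta> - \<rho> / X)" "\<rho>' / X"] dX[OF \<rho>']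
        by linarith
    qed
    finally have "cmod (k - b + b / X) \<le> 5 * exp (2 * X) / sqrt X / (4 * X\<^sup>2) + 40 * e" by simp
    then show ?case using elim(1) by (simp add: a_def b_def k_def e_def)
  qed
qed

section \<open>From the circle integral to the saddle point integrals\<close>

text \<open>
  On the major arc \<open>exp H\<close> is constant up to a relative error \<open>O(\<bar>z - a\<bar>)\<close>, and its value at \<open>a\<close>
  stays away from \<open>0\<close> as \<open>a\<close> tends to \<open>0\<close>.
\<close>
lemma gf_correction_bounds:
  obtains C K where "C > 0"
    "\<And>a t. 0 < a \<Longrightarrow> a \<le> 1 \<Longrightarrow> \<bar>t\<bar> \<le> 1 \<Longrightarrow>
       cmod (exp (gf_correction (of_real a * (1 + \<i> * of_real t)) - gf_correction (of_real a)) - 1) \<le> C * a * \<bar>t\<bar>"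
    "\<And>a. 0 < a \<Longrightarrow> a \<le> 1 \<Longrightarrow> exp (- K) \<le> cmod (exp (gf_correction (of_real a)))"
proof -
  obtain L where L: "L > 0" "\<And>z w. z \<in> sector \<Longrightarrow> w \<in> sector \<Longrightarrow> z \<noteq> 0 \<Longrightarrow> w \<noteq> 0 \<Longrightarrow>
    cmod z \<le> 2 \<Longrightarrow> cmod w \<le> 2 \<Longrightarrow> cmod (gf_correction z - gf_correction w) \<le> L * cmod (z - w)"
    using gf_correction_lipschitz by blast
  have "cmod (exp (gf_correction (of_real a * (1 + \<i> * of_real t)) - gf_correction (of_real a)) - 1) \<le> (exp L * L) * a * \<bar>t\<bar>"
    if a: "0 < a" "a \<le> 1" and t: "\<bar>t\<bar> \<le> 1" for a t
  proof -
    define z where "z = of_real a * (1 + \<i> * of_real t)"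
    define w where "w = gf_correction z - gf_correction (of_real a)"
    have z: "z \<in> sector" "z \<noteq> 0" using a t by (auto simp: z_def sector_def abs_mult complex_eq_iff)
    have za: "cmod (z - of_real a) = a * \<bar>t\<bar>" using a by (simp add: z_def algebra_simps norm_mult)
    have at: "a * \<bar>t\<bar> \<le> 1" using mult_mono[of a 1 "\<bar>t\<bar>" 1] a t by simp
    have "cmod z \<le> 2" using norm_triangle_ineq[of "z - of_real a" "of_real a"] za at a by simp
    then have w: "cmod w \<le> L * (a * \<bar>t\<bar>)"
      using L(2)[of z "of_real a"] z a unfolding w_def za by (simp add: sector_def)
    also have "\<dots> \<le> L" using at L(1) by simp
    finally have wL: "cmod w \<le> L" .
    have "cmod (exp w - 1) \<le> exp (cmod w) * cmod w" using Taylor_exp_field[of w 0] by simp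
    also have "\<dots> \<le> exp L * (L * (a * \<bar>t\<bar>))" using w wL by (intro mult_mono) auto
    finally show ?thesis by (simp add: w_def z_def mult_ac)
  qed
  moreover have "exp (- (cmod (gf_correction 1) + L)) \<le> cmod (exp (gf_correction (of_real a)))" if a: "0 < a" "a \<le> 1" for a
  proof -
    have "cmod (gf_correction (of_real a) - gf_correction 1) \<le> L * cmod (of_real a - 1)"
      using L(2)[of "of_real a" 1] a by (simp add: sector_def)
    also have "cmod (of_real a - 1) = 1 - a"
      using a norm_of_real[of "a - 1", where ?'a = complex] by simp
    also have "L * (1 - a) \<le> L" using a L(1) by (simp add: algebra_simps)
    finally have "\<bar>Re (gf_correction (of_real a) - gf_correction 1)\<bar> \<le> L"
      using abs_Re_le_cmod order_trans by blast
    moreover have "\<bar>Re (gf_correction 1)\<bar> \<le> cmod (gf_correction 1)" by (rule abs_Re_le_cmod)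
    ultimately have "- (cmod (gf_correction 1) + L) \<le> Re (gf_correction (of_real a))" by simp
    then show ?thesis by simp
  qed
  ultimately show thesis using that[of "exp L * L" "cmod (gf_correction 1) + L"] L(1) by simp
qed

lemma csqrt_of_real_mult:
  assumes "a > 0" shows "csqrt (of_real a * z) = of_real (sqrt a) * csqrt z"
proof -
  have "csqrt (of_real a * z) = csqrt (of_real a) * csqrt z"
    using assms by (intro csqrt_mult) (simp add: Arg_of_real mpi_less_Arg Arg_le_pi)
  then show ?thesis using assms by simp
qed

text \<open>
  With \<open>a = c^2 / X\<close> and \<open>n * a = X\<close> the two terms of the exponent become \<open>X / \<zeta>\<close> and \<open>X * \<zeta>\<close> at
  \<open>z = a * \<zeta>\<close>.
\<close>
lemma integrand_major_arc:
  assumes "a > 0" "of_nat n * a = X" "pi\<^sup>2 / 6 / a = X" "z \<noteq> 0"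
  shows "exp (log_gf (of_real a * z)) * exp (of_nat n * (of_real a * z)) =
     exp (gf_correction (of_real a)) * of_real (sqrt a) *
     (exp (gf_correction (of_real a * z) - gf_correction (of_real a)) * (csqrt z * saddle_exp X z))"
proof -
  have 1: "of_nat n * (of_real a * z) = of_real X * z"
    unfolding assms(2)[symmetric] by (simp add: mult.assoc)
  have 2: "of_real (pi\<^sup>2 / 6) / (of_real a * z) = of_real X / z"
    unfolding assms(3)[symmetric] by simp
  have nz: "of_real a * z \<noteq> 0" using assms by simp
  have s: "exp (of_real X / z) * exp (of_real X * z) = saddle_exp X z"
    by (simp add: saddle_exp_def exp_add[symmetric] algebra_simps)
  show ?thesis
    unfolding exp_log_gf[OF nz] 1 2 csqrt_of_real_mult[OF assms(1)] s[symmetric]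
    by (simp add: exp_diff)
qed

lemma log_gf_holomorphic: "log_gf holomorphic_on {z. Re z > 0}"
  using log_gf_derivative(2) by (auto simp: holomorphic_on_open open_halfspace_Re_gt)

lemma continuous_on_gf_correction:
  assumes "a > 0"
  shows "continuous_on S (\<lambda>t::real. exp (gf_correction (of_real a * (1 + \<i> * of_real t)) - gf_correction (of_real a)))"
proof -
  have "gf_correction holomorphic_on {z. Re z > 0}"
    unfolding gf_correction_def[abs_def]
    by (intro holomorphic_intros log_gf_holomorphic) (auto simp: complex_nonpos_Reals_iff)
  then have "continuous_on S (gf_correction \<circ> (\<lambda>t::real. of_real a * (1 + \<i> * of_real t)))"
    by (intro continuous_on_compose continuous_intros
        continuous_on_subset[OF holomorphic_on_imp_continuous_on]) (use assms in auto)
  then show ?thesis unfolding o_def by (intro continuous_intros)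
qed

lemma continuous_on_integrand:
  assumes "a > 0"
  shows "continuous_on S (\<lambda>y. exp (log_gf (Complex a y)) * exp (of_nat n * Complex a y))"
proof -
  have e: "Complex a y = of_real a + \<i> * of_real y" for y by (simp add: complex_eq_iff)
  have "continuous_on S (log_gf \<circ> (\<lambda>y. of_real a + \<i> * of_real y))"
    by (intro continuous_on_compose continuous_intros
        continuous_on_subset[OF holomorphic_on_imp_continuous_on[OF log_gf_holomorphic]])
      (use assms in auto)
  then show ?thesis unfolding e o_def by (intro continuous_intros)
qed

text \<open>
  The integral over the whole period, with a bounded weight \<open>w\<close>, differs little from the integral
  over \<open>\<bar>y\<bar> \<le> a\<close>, which is rescaled by \<open>y = a * t\<close>.
\<close>
lemma minor_arc_split:
  fixes w :: "real \<Rightarrow> complex" and n :: nat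
  assumes a: "0 < a" "a \<le> 1" and w: "continuous_on {-pi..pi} w" "\<And>y. cmod (w y) \<le> 5"
  defines "g \<equiv> \<lambda>y. w y * (exp (log_gf (Complex a y)) * exp (of_nat n * Complex a y))"
  shows "cmod (integral {-pi..pi} g - of_real a * integral {-1..1} (\<lambda>t. g (a * t)))
     \<le> 10 * pi * (exp ((pi\<^sup>2 / 6 - 1 / 6) / a) * exp (of_nat n * a))"
proof -
  define M where "M = 5 * (exp ((pi\<^sup>2 / 6 - 1 / 6) / a) * exp (of_nat n * a))"
  have M0: "M \<ge> 0" by (simp add: M_def)
  have api: "a \<le> pi" using a pi_gt3 by linarith
  have cont: "continuous_on {-pi..pi} g" unfolding g_def
    by (intro continuous_on_mult w continuous_on_integrand a)
  have int: "g integrable_on {-pi..pi}" using cont by (rule integrable_continuous_real)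
  have sub: "g integrable_on {u..v}" if "-pi \<le> u" "v \<le> pi" for u v
    using integrable_subinterval_real[OF int] that by auto
  have bound: "cmod (g y) \<le> M" if "a \<le> \<bar>y\<bar>" "\<bar>y\<bar> \<le> pi" for y
  proof -
    have "cmod (g y) \<le> 5 * (exp ((pi\<^sup>2 / 6 - 1 / 6) / a) * exp (of_nat n * a))"
      unfolding g_def norm_mult
      using log_gf_minor_bound[OF a that] by (intro mult_mono w) auto
    then show ?thesis by (simp add: M_def)
  qed
  have le: "cmod (integral {u..v} g) \<le> M * pi"
    if "-pi \<le> u" "u \<le> v" "v \<le> pi" "v - u \<le> pi" "\<And>y. u \<le> y \<Longrightarrow> y \<le> v \<Longrightarrow> a \<le> \<bar>y\<bar>" for u v
  proof -
    have "cmod (integral {u..v} g) \<le> M * (v - u)"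
      by (rule integral_bound) (use that cont bound in \<open>auto intro!: continuous_on_subset[OF cont] bound\<close>)
    also have "\<dots> \<le> M * pi" using that M0 by (intro mult_left_mono) auto
    finally show ?thesis .
  qed
  have "integral {-pi..pi} g = integral {-pi..-a} g + integral {-a..pi} g"
    using Henstock_Kurzweil_Integration.integral_combine[of "-pi" "-a" pi g] int api a by simp
  also have "integral {-a..pi} g = integral {-a..a} g + integral {a..pi} g"
    using Henstock_Kurzweil_Integration.integral_combine[of "-a" a pi g] sub[of "-a" pi] api a by simp
  also have "integral {-a..a} g = of_real a * integral {-1..1} (\<lambda>t. g (a * t))"
  proof -
    have "(g has_integral integral {-a..a} g) {-a..a}" using sub[of "-a" a] api by (intro integrable_integral) auto
    from has_integral_stretch_real[OF this, of a] a
    have "((\<lambda>t. g (a * t)) has_integral (1 / a) *\<^sub>R integral {-a..a} g) ((\<lambda>x. x / a) ` {-a..a})" by simp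
    also have "(\<lambda>x. x / a) ` {-a..a} = {-1..1}" using a by (subst image_divide_atLeastAtMost) auto
    finally have "integral {-1..1} (\<lambda>t. g (a * t)) = (1 / a) *\<^sub>R integral {-a..a} g" by (rule integral_unique)
    then show ?thesis using a by (simp add: scaleR_conv_of_real)
  qed
  finally have "integral {-pi..pi} g - of_real a * integral {-1..1} (\<lambda>t. g (a * t))
     = integral {-pi..-a} g + integral {a..pi} g" by simp
  also have "cmod \<dots> \<le> M * pi + M * pi"
    by (rule norm_triangle_mono; rule le) (use a api in auto)
  finally show ?thesis by (simp add: M_def mult_ac)
qed

text \<open>
  The factor \<open>E\<close> stands for \<open>exp (H z - H a)\<close>.  The constant \<open>\<kappa>\<close> is chosen such that
  \<open>1 - exp (- z) - \<kappa>\<close> equals \<open>exp (- a) * a * (\<i> * t + 1 / X)\<close> up to \<open>O(a^2 * t^2)\<close>; the leading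
  part integrates to the drift term, and every other contribution is quadratic in \<open>t\<close> or \<open>1 / X\<close>.
\<close>
lemma major_arc_estimate:
  fixes E :: "real \<Rightarrow> complex"
  assumes cE: "continuous_on {-1..1} E" and a: "0 < a" "a \<le> 1" and X: "X \<ge> 1"
    and C: "C \<ge> 0" "\<And>t. \<bar>t\<bar> \<le> 1 \<Longrightarrow> cmod (E t - 1) \<le> C * a * \<bar>t\<bar>"
  defines "f \<equiv> \<lambda>t. csqrt (1 + \<i> * of_real t) * saddle_exp X (1 + \<i> * of_real t)"
    and "\<kappa> \<equiv> 1 - exp (-a) - exp (-a) * a / X"
  shows "cmod (saddle_integral 1 X) - C * a * (10 * exp (2 * X) / sqrt X) \<le> cmod (integral {-1..1} (\<lambda>t. E t * f t))"
    and "cmod (integral {-1..1} (\<lambda>t. (1 - exp (- (of_real a * (1 + \<i> * of_real t))) - of_real \<kappa>) * (E t * f t)))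
       \<le> a * cmod (saddle_integral 3 X - saddle_integral 1 X + saddle_integral 1 X / X)
         + (3 * C + 1) * a\<^sup>2 * (50 * exp (2 * X) / (X * sqrt X))"
proof -
  have cf: "continuous_on {-1..1} f" unfolding f_def by (intro continuous_intros)
  have f: "f integrable_on {-1..1}" "(\<lambda>t. E t * f t) integrable_on {-1..1}"
    "(\<lambda>t. cmod (f t)) integrable_on {-1..1}" "(\<lambda>t. t\<^sup>2 * cmod (f t)) integrable_on {-1..1}"
    by (intro integrable_continuous_real continuous_intros cf cE)+
  have nf: "integral {-1..1} (\<lambda>t. cmod (f t)) \<le> 10 * exp (2 * X) / sqrt X"
    using integral_saddle_bounds(1)[of X] X by (simp add: f_def)
  have nf2: "integral {-1..1} (\<lambda>t. t\<^sup>2 * cmod (f t)) \<le> 40 * exp (2 * X) / (X * sqrt X)"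
    using integral_saddle_bounds(2)[of X] X by (simp add: f_def norm_mult norm_power)
  have s1: "integral {-1..1} f = saddle_integral 1 X" by (simp add: saddle_integral_def f_def)
  have s3: "((\<lambda>t. \<i> * of_real t * f t) has_integral (saddle_integral 3 X - saddle_integral 1 X)) {-1..1}"
  proof -
    have "csqrt z powi 3 * s - csqrt z powi 1 * s = (z - 1) * (csqrt z * s)" for z s :: complex
    proof -
      have "csqrt z powi 3 = (csqrt z)\<^sup>2 * csqrt z" by (simp add: power3_eq_cube power2_eq_square del: power2_csqrt)
      then show ?thesis by (simp add: algebra_simps)
    qed
    from this[of "1 + \<i> * of_real _"] show ?thesis
      using has_integral_diff[OF saddle_integral_has_integral[of 3 X] saddle_integral_has_integral[of 1 X]]
      by (simp add: f_def)
  qed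
  have "integral {-1..1} (\<lambda>t. E t * f t) - saddle_integral 1 X = integral {-1..1} (\<lambda>t. (E t - 1) * f t)"
    using integral_diff[OF f(2,1)] by (simp add: s1 algebra_simps)
  also have "cmod \<dots> \<le> integral {-1..1} (\<lambda>t. C * a * cmod (f t))"
  proof (rule integral_norm_bound_integral)
    fix t :: real assume "t \<in> {-1..1}"
    then have t: "\<bar>t\<bar> \<le> 1" by auto
    have "C * a * \<bar>t\<bar> \<le> C * a * 1" using C a t by (intro mult_left_mono) auto
    then have "cmod (E t - 1) \<le> C * a" using C(2)[OF t] by simp
    then show "cmod ((E t - 1) * f t) \<le> C * a * cmod (f t)" unfolding norm_mult by (intro mult_right_mono) auto
  qed (intro integrable_continuous_real continuous_intros cf cE)+
  also have "\<dots> = C * a * integral {-1..1} (\<lambda>t. cmod (f t))" by simp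
  also have "\<dots> \<le> C * a * (10 * exp (2 * X) / sqrt X)" using nf C a by (intro mult_left_mono) auto
  finally have "cmod (integral {-1..1} (\<lambda>t. E t * f t) - saddle_integral 1 X) \<le> C * a * (10 * exp (2 * X) / sqrt X)" .
  then show "cmod (saddle_integral 1 X) - C * a * (10 * exp (2 * X) / sqrt X) \<le> cmod (integral {-1..1} (\<lambda>t. E t * f t))"
    using norm_triangle_ineq3[of "integral {-1..1} (\<lambda>t. E t * f t)" "saddle_integral 1 X"] by linarith

  define W where "W = (\<lambda>t. 1 - exp (- (of_real a * (1 + \<i> * of_real t))) - complex_of_real \<kappa>)"
  define A where "A = (\<lambda>t. of_real (exp (-a) * a) * (\<i> * of_real t + 1 / of_real X) :: complex)"
  have cW: "continuous_on {-1..1} W" unfolding W_def by (intro continuous_intros)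
  have cA: "continuous_on {-1..1} A" unfolding A_def by (intro continuous_intros)
  have intA: "integral {-1..1} (\<lambda>t. A t * f t) = of_real (exp (-a) * a) * (saddle_integral 3 X - saddle_integral 1 X + saddle_integral 1 X / X)"
  proof (rule integral_unique)
    have "((\<lambda>t. of_real (exp (-a) * a) * (\<i> * of_real t * f t + f t / of_real X)) has_integral
        of_real (exp (-a) * a) * (saddle_integral 3 X - saddle_integral 1 X + saddle_integral 1 X / X)) {-1..1}"
      using f(1) unfolding s1[symmetric]
      by (intro has_integral_mult_right has_integral_add s3[unfolded s1[symmetric]] has_integral_divide integrable_integral)
    then show "((\<lambda>t. A t * f t) has_integral
        of_real (exp (-a) * a) * (saddle_integral 3 X - saddle_integral 1 X + saddle_integral 1 X / X)) {-1..1}"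
      by (simp add: A_def algebra_simps)
  qed
  have ea: "exp (-a) \<le> 1" using a by simp
  have pt: "cmod (W t * E t - A t) \<le> (3 * C + 1) * a\<^sup>2 * (t\<^sup>2 + 1 / X\<^sup>2)" if t: "\<bar>t\<bar> \<le> 1" for t
  proof -
    define u where "u = - \<i> * of_real (a * t)"
    have "W t - A t = - of_real (exp (-a)) * (exp u - 1 - u)"
    proof -
      have "exp (- (of_real a * (1 + \<i> * of_real t))) = exp (of_real (-a)) * exp u"
        unfolding exp_add[symmetric] by (simp add: u_def algebra_simps)
      then show ?thesis using X
        by (simp add: W_def A_def \<kappa>_def u_def exp_of_real[symmetric] field_simps)
    qed
    moreover have "cmod (exp u - 1 - u) \<le> a\<^sup>2 * t\<^sup>2"
      using Taylor_exp[of u 1] by (simp add: u_def norm_mult power_mult_distrib algebra_simps power2_eq_square[of "_ * _"] abs_mult power2_eq_square)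
    ultimately have WA: "cmod (W t - A t) \<le> a\<^sup>2 * t\<^sup>2"
      using mult_mono[OF ea, of "cmod (exp u - 1 - u)" "a\<^sup>2 * t\<^sup>2"] by (simp add: norm_mult)
    \<comment> \<open>The mixed product is absorbed by the inequality of arithmetic and geometric means.\<close>
    have x: "2 * (\<bar>t\<bar> * (1 / X)) \<le> t\<^sup>2 + 1 / X\<^sup>2"
      using zero_le_power2[of "\<bar>t\<bar> - 1 / X"] by (simp add: power2_diff power_divide)
    have Et: "cmod (E t - 1) \<le> C * a * \<bar>t\<bar>" using C(2)[OF t] .
    have "C * a * \<bar>t\<bar> \<le> C * 1 * 1" using C a t by (intro mult_mono) auto
    then have E1: "cmod (E t) \<le> 1 + C" using Et norm_triangle_sub[of "E t" 1] by simp
    have "cmod (A t) \<le> a * (\<bar>t\<bar> + 1 / X)"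
    proof -
      have "cmod (A t) = exp (-a) * a * cmod (\<i> * of_real t + 1 / of_real X)"
        using a by (simp add: A_def norm_mult)
      also have "cmod (\<i> * of_real t + 1 / of_real X) \<le> \<bar>t\<bar> + 1 / X"
        using norm_triangle_ineq[of "\<i> * of_real t" "1 / of_real X"] X by (simp add: norm_mult norm_divide)
      also have "exp (-a) * a * (\<bar>t\<bar> + 1 / X) \<le> 1 * a * (\<bar>t\<bar> + 1 / X)"
        using ea a X by (intro mult_right_mono) auto
      finally show ?thesis using a by (simp add: mult_left_mono)
    qed
    then have "cmod (A t * (E t - 1)) \<le> (a * (\<bar>t\<bar> + 1 / X)) * (C * a * \<bar>t\<bar>)"
      unfolding norm_mult using Et a X by (intro mult_mono) auto
    also have "\<dots> = C * a\<^sup>2 * (t\<^sup>2 + \<bar>t\<bar> * (1 / X))" by (simp add: power2_eq_square algebra_simps)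
    also have "\<dots> \<le> C * a\<^sup>2 * (2 * (t\<^sup>2 + 1 / X\<^sup>2))"
    proof (intro mult_left_mono)
      have "0 \<le> 1 / X\<^sup>2" "0 \<le> t\<^sup>2" by simp_all
      with x show "t\<^sup>2 + \<bar>t\<bar> * (1 / X) \<le> 2 * (t\<^sup>2 + 1 / X\<^sup>2)" by argo
    qed (use C in auto)
    also have "\<dots> = 2 * C * a\<^sup>2 * (t\<^sup>2 + 1 / X\<^sup>2)" by (simp only: mult_ac)
    finally have AE: "cmod (A t * (E t - 1)) \<le> 2 * C * a\<^sup>2 * (t\<^sup>2 + 1 / X\<^sup>2)" .
    define q where "q = t\<^sup>2 + 1 / X\<^sup>2"
    have "t\<^sup>2 \<le> q" "0 \<le> q" by (simp_all add: q_def)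
    then have WA': "cmod (W t - A t) \<le> a\<^sup>2 * q"
      using WA by (meson mult_left_mono order_trans zero_le_power2)
    have "W t * E t - A t = (W t - A t) * E t + A t * (E t - 1)" by (simp add: algebra_simps)
    then have "cmod (W t * E t - A t) \<le> cmod ((W t - A t) * E t) + cmod (A t * (E t - 1))"
      by (simp only: norm_triangle_ineq)
    also have "cmod ((W t - A t) * E t) \<le> (a\<^sup>2 * q) * (1 + C)"
      unfolding norm_mult using WA' E1 \<open>0 \<le> q\<close> by (intro mult_mono) auto
    also have "cmod (A t * (E t - 1)) \<le> 2 * C * a\<^sup>2 * q" using AE by (simp only: q_def)
    finally have "cmod (W t * E t - A t) \<le> (3 * C + 1) * a\<^sup>2 * q" by (simp add: algebra_simps)
    then show ?thesis by (simp only: q_def)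
  qed
  have "integral {-1..1} (\<lambda>t. W t * (E t * f t)) - integral {-1..1} (\<lambda>t. A t * f t)
      = integral {-1..1} (\<lambda>t. (W t * E t - A t) * f t)"
  proof -
    have "(\<lambda>t. W t * (E t * f t)) integrable_on {-1..1}" "(\<lambda>t. A t * f t) integrable_on {-1..1}"
      by (intro integrable_continuous_real continuous_intros cW cA cE cf)+
    from integral_diff[OF this] show ?thesis by (simp add: algebra_simps)
  qed
  also have "cmod \<dots> \<le> integral {-1..1} (\<lambda>t. (3 * C + 1) * a\<^sup>2 * (t\<^sup>2 * cmod (f t) + 1 / X\<^sup>2 * cmod (f t)))"
  proof (rule integral_norm_bound_integral)
    fix t :: real assume "t \<in> {-1..1}"
    then have t: "\<bar>t\<bar> \<le> 1" by auto
    have "cmod ((W t * E t - A t) * f t) \<le> ((3 * C + 1) * a\<^sup>2 * (t\<^sup>2 + 1 / X\<^sup>2)) * cmod (f t)"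
      unfolding norm_mult by (intro mult_right_mono pt t) auto
    then show "cmod ((W t * E t - A t) * f t) \<le> (3 * C + 1) * a\<^sup>2 * (t\<^sup>2 * cmod (f t) + 1 / X\<^sup>2 * cmod (f t))"
      by (simp add: algebra_simps)
  qed (intro integrable_continuous_real continuous_intros cf cE cA cW)+
  also have "\<dots> = (3 * C + 1) * a\<^sup>2 * (integral {-1..1} (\<lambda>t. t\<^sup>2 * cmod (f t)) + 1 / X\<^sup>2 * integral {-1..1} (\<lambda>t. cmod (f t)))"
  proof (rule integral_unique)
    show "((\<lambda>t. (3 * C + 1) * a\<^sup>2 * (t\<^sup>2 * cmod (f t) + 1 / X\<^sup>2 * cmod (f t))) has_integral
      (3 * C + 1) * a\<^sup>2 * (integral {-1..1} (\<lambda>t. t\<^sup>2 * cmod (f t)) + 1 / X\<^sup>2 * integral {-1..1} (\<lambda>t. cmod (f t)))) {-1..1}"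
      by (intro has_integral_mult_right has_integral_add integrable_integral f)
  qed
  also have "\<dots> \<le> (3 * C + 1) * a\<^sup>2 * (40 * exp (2 * X) / (X * sqrt X) + 1 / X\<^sup>2 * (10 * exp (2 * X) / sqrt X))"
    using C by (intro mult_left_mono add_mono nf nf2) auto
  also have "\<dots> \<le> (3 * C + 1) * a\<^sup>2 * (40 * exp (2 * X) / (X * sqrt X) + 1 / X * (10 * exp (2 * X) / sqrt X))"
  proof -
    have "1 / X\<^sup>2 \<le> 1 / X" using X by (intro divide_left_mono) (auto simp: power2_eq_square)
    then show ?thesis using C X by (intro mult_left_mono add_left_mono mult_right_mono) auto
  qed
  also have "\<dots> = (3 * C + 1) * a\<^sup>2 * (50 * exp (2 * X) / (X * sqrt X))" by simp
  finally have d: "cmod (integral {-1..1} (\<lambda>t. W t * (E t * f t)) - integral {-1..1} (\<lambda>t. A t * f t))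
     \<le> (3 * C + 1) * a\<^sup>2 * (50 * exp (2 * X) / (X * sqrt X))" .
  have "cmod (integral {-1..1} (\<lambda>t. A t * f t)) \<le> a * cmod (saddle_integral 3 X - saddle_integral 1 X + saddle_integral 1 X / X)"
    unfolding intA norm_mult norm_of_real using ea a by (intro mult_right_mono) (auto simp: abs_mult)
  then show "cmod (integral {-1..1} (\<lambda>t. (1 - exp (- (of_real a * (1 + \<i> * of_real t))) - of_real \<kappa>) * (E t * f t)))
       \<le> a * cmod (saddle_integral 3 X - saddle_integral 1 X + saddle_integral 1 X / X)
         + (3 * C + 1) * a\<^sup>2 * (50 * exp (2 * X) / (X * sqrt X))"
    using d norm_triangle_sub[of "integral {-1..1} (\<lambda>t. W t * (E t * f t))" "integral {-1..1} (\<lambda>t. A t * f t)"]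
    unfolding W_def by linarith
qed

text \<open>
  The minor arc contribution is below the main term by any power of \<open>X\<close>; the power \<open>3\<close> is the
  one needed.
\<close>
lemma minor_arc_negligible:
  fixes c2 \<eta> :: real
  assumes "c2 > 0" "\<eta> > 0"
  shows "eventually (\<lambda>X::real. 10 * pi * (exp (X - X / (6 * c2)) * exp X) \<le> c2 / X * (\<eta> * sqrt (c2 / X)) * (exp (2 * X) / sqrt X) / (16 * X ^ 3)) at_top"
proof -
  have "eventually (\<lambda>X::real. 10 * pi * exp (- (X / (6 * c2))) \<le> c2 / X * (\<eta> * sqrt (c2 / X)) * (1 / sqrt X) / (16 * X ^ 3)) at_top"
    using assms by real_asymp
  then show ?thesis
  proof eventually_elim
    case (elim X)
    have "exp (X - X / (6 * c2)) * exp X = exp (2 * X) * exp (- (X / (6 * c2)))"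
      by (simp add: exp_add[symmetric])
    then show ?case using mult_left_mono[OF elim, of "exp (2 * X)"] by (simp add: mult_ac)
  qed
qed

lemma ratio_main_term_expansion:
  fixes c :: real
  assumes "c > 0"
  shows "(\<lambda>n::nat. exp (- (c / sqrt (real n))) * (1 + 1 / real n) - (1 - c / sqrt (real n) + (1 + c\<^sup>2 / 2) / real n))
     \<in> O(\<lambda>n. real n powr (-3/2))"
proof -
  have lim: "filterlim (\<lambda>n::nat. c / sqrt (real n)) (at_right 0) sequentially"
    using assms by real_asymp
  have 1: "(\<lambda>x::real. exp (-x) - (1 - x + x\<^sup>2 / 2)) \<in> O[at_right 0](\<lambda>x. x ^ 3)"
    by real_asymp
  have 2: "(\<lambda>x::real. exp (-x) - 1) \<in> O[at_right 0](\<lambda>x. x)"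
    by real_asymp
  have "(\<lambda>n::nat. exp (- (c / sqrt (real n))) - (1 - c / sqrt (real n) + (c / sqrt (real n))\<^sup>2 / 2))
      \<in> O(\<lambda>n. (c / sqrt (real n)) ^ 3)"
    by (rule landau_o.big.compose[OF 1 lim])
  also have "(\<lambda>n::nat. (c / sqrt (real n)) ^ 3) \<in> O(\<lambda>n. real n powr (-3/2))"
    using assms by real_asymp
  finally have A: "(\<lambda>n::nat. exp (- (c / sqrt (real n))) - (1 - c / sqrt (real n) + (c / sqrt (real n))\<^sup>2 / 2))
      \<in> O(\<lambda>n. real n powr (-3/2))" .
  have "(\<lambda>n::nat. (exp (- (c / sqrt (real n))) - 1) * (1 / real n)) \<in> O(\<lambda>n. c / sqrt (real n) * (1 / real n))"
    by (intro landau_o.big.mult landau_o.big.compose[OF 2 lim] landau_o.big_refl)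
  also have "(\<lambda>n::nat. c / sqrt (real n) * (1 / real n)) \<in> O(\<lambda>n. real n powr (-3/2))"
    using assms by real_asymp
  finally have B: "(\<lambda>n::nat. (exp (- (c / sqrt (real n))) - 1) * (1 / real n)) \<in> O(\<lambda>n. real n powr (-3/2))" .
  show ?thesis
    using sum_in_bigo(1)[OF A B] by (simp add: power_divide algebra_simps add_divide_distrib)
qed

section \<open>The ratio of consecutive partition numbers\<close>

text \<open>
  Here \<open>X = c * sqrt n\<close> and \<open>pi^2 / 6 / X = c / sqrt n\<close>, so the second factor of the main term is
  \<open>1 + 1 / n\<close> and the error is of order \<open>n powr (- 3/2)\<close>.
\<close>
lemma partition_ratio_estimate:
  "\<exists>B. \<forall>\<^sub>F n in sequentially. \<forall>X. X = pi / sqrt 6 * sqrt (real n) \<longrightarrow>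
     \<bar>real (partition_count (n - 1)) / real (partition_count n)
        - exp (- (pi\<^sup>2 / 6 / X)) * (1 + pi\<^sup>2 / 6 / X / X)\<bar> \<le> B / X ^ 3"
proof -
  obtain C K where C: "C > 0"
    "\<And>a t. 0 < a \<Longrightarrow> a \<le> 1 \<Longrightarrow> \<bar>t\<bar> \<le> 1 \<Longrightarrow>
       cmod (exp (gf_correction (of_real a * (1 + \<i> * of_real t)) - gf_correction (of_real a)) - 1) \<le> C * a * \<bar>t\<bar>"
    and K: "\<And>a. 0 < a \<Longrightarrow> a \<le> 1 \<Longrightarrow> exp (- K) \<le> cmod (exp (gf_correction (of_real a)))"
    using gf_correction_bounds by blast
  define c2 :: real where "c2 = pi\<^sup>2 / 6"
  have c2: "c2 > 0" by (simp add: c2_def)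
  define B0 where "B0 = 2 * c2 + 50 * (3 * C + 1) * c2\<^sup>2 + 1 / 16"
  have e3: "\<forall>\<^sub>F X in at_top. 10 * C * (c2 / X) \<le> 1 / 8" using C(1) c2 by real_asymp
  have e5: "\<forall>\<^sub>F X in at_top. c2 / X \<le> 1" using c2 by real_asymp
  have X: "filterlim (\<lambda>n. pi / sqrt 6 * sqrt (real n)) at_top sequentially" by real_asymp
  have ev: "\<forall>\<^sub>F X in at_top. \<forall>n. X = pi / sqrt 6 * sqrt (real n) \<longrightarrow>
    \<bar>real (partition_count (n - 1)) / real (partition_count n)
        - exp (- (c2 / X)) * (1 + c2 / X / X)\<bar> \<le> 16 * B0 / X ^ 3"
    using saddle_integral_lower saddle_integral_drift e3 minor_arc_negligible[OF c2 exp_gt_zero[of "- K"]] e5 eventually_ge_at_top[of 1]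
  proof (eventually_elim, intro allI impI)
    fix X :: real and n :: nat
    assume lower: "1 / 4 * exp (2 * X) / sqrt X \<le> cmod (saddle_integral 1 X)"
      and drift: "cmod (saddle_integral 3 X - saddle_integral 1 X + saddle_integral 1 X / X)
         \<le> 2 * exp (2 * X) / (X\<^sup>2 * sqrt X)"
      and Ca: "10 * C * (c2 / X) \<le> 1 / 8"
      and minor: "10 * pi * (exp (X - X / (6 * c2)) * exp X)
         \<le> c2 / X * (exp (- K) * sqrt (c2 / X)) * (exp (2 * X) / sqrt X) / (16 * X ^ 3)"
      and a1: "c2 / X \<le> 1" and X1: "1 \<le> X" and Xn: "X = pi / sqrt 6 * sqrt (real n)"
    define a m where "a = c2 / X" and "m = exp (2 * X) / sqrt X"
    have a: "0 < a" "a \<le> 1" using c2 X1 a1 by (auto simp: a_def)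
    have X0: "X > 0" using X1 by simp
    have m0: "m > 0" using X0 by (simp add: m_def)
    have n0: "n \<ge> 1" using Xn X1 by (cases n) auto
    have X2: "X * X = c2 * real n" by (simp add: Xn c2_def power2_eq_square)
    have na: "real n * a = X" using X2 X0 by (simp add: a_def field_simps)
    have ca: "c2 / a = X" using c2 X0 by (simp add: a_def)
    define \<kappa> where "\<kappa> = 1 - exp (-a) - exp (-a) * a / X"
    define E where "E = (\<lambda>t. exp (gf_correction (of_real a * (1 + \<i> * of_real t)) - gf_correction (of_real a)))"
    define f where "f = (\<lambda>t. csqrt (1 + \<i> * of_real t) * saddle_exp X (1 + \<i> * of_real t))"
    define F where "F = (\<lambda>y. exp (log_gf (Complex a y)) * exp (of_nat n * Complex a y))"
    define V where "V = exp (gf_correction (of_real a)) * of_real (sqrt a)"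
    have cE: "continuous_on {-1..1} E" unfolding E_def by (rule continuous_on_gf_correction[OF a(1)])
    have Fa: "F (a * t) = V * (E t * f t)" for t
    proof -
      have "Complex a (a * t) = of_real a * (1 + \<i> * of_real t)" by (simp add: complex_eq_iff)
      moreover have "1 + \<i> * complex_of_real t \<noteq> 0" by (simp add: complex_eq_iff)
      ultimately show ?thesis
        using integrand_major_arc[of a n X "1 + \<i> * of_real t"] a na ca
        by (simp add: F_def V_def E_def f_def c2_def)
    qed
    have mn: "exp ((pi\<^sup>2 / 6 - 1 / 6) / a) * exp (of_nat n * a) = exp (X - X / (6 * c2)) * exp X"
    proof -
      have "(pi\<^sup>2 / 6 - 1 / 6) / a = c2 / a - (c2 / a) / (6 * c2)"
        using c2 a by (simp add: c2_def diff_divide_distrib)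
      then show ?thesis unfolding ca na by simp
    qed
    have V: "exp (- K) * sqrt a \<le> cmod V"
      using K[OF a] a by (simp add: V_def norm_mult mult_right_mono)
    \<comment> \<open>\<open>D\<close> is the order of magnitude of \<open>2 * pi * p n\<close>.\<close>
    define D where "D = a * cmod V * m"
    have V0: "cmod V > 0" using a by (simp add: V_def)
    have D0: "D > 0" using a V0 m0 by (simp add: D_def)
    have minor': "10 * pi * (exp ((pi\<^sup>2 / 6 - 1 / 6) / a) * exp (of_nat n * a)) \<le> D / (16 * X ^ 3)"
    proof -
      have "10 * pi * (exp ((pi\<^sup>2 / 6 - 1 / 6) / a) * exp (of_nat n * a)) \<le> a * (exp (- K) * sqrt a) * m / (16 * X ^ 3)"
        unfolding mn using minor by (simp only: a_def m_def)
      also have "\<dots> \<le> a * cmod V * m / (16 * X ^ 3)"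
        using V a m0 X0 by (intro divide_right_mono mult_right_mono mult_left_mono) auto
      finally show ?thesis by (simp add: D_def)
    qed
    have Cle: "C \<ge> 0" "\<And>t. \<bar>t\<bar> \<le> 1 \<Longrightarrow> cmod (E t - 1) \<le> C * a * \<bar>t\<bar>"
      using C a by (auto simp: E_def)
    have f_eq: "csqrt (1 + \<i> * of_real t) * saddle_exp X (1 + \<i> * of_real t) = f t" for t
      by (simp add: f_def)
    note major = major_arc_estimate[OF cE a X1 Cle, unfolded f_eq, folded \<kappa>_def]
    have I0: "integral {-pi..pi} F = of_real (2 * pi * real (partition_count n))"
      unfolding F_def by (rule integral_unique[OF partition_count_has_integral[OF a(1)]])
    have I1: "integral {-pi..pi} (\<lambda>y. (1 - exp (- Complex a y) - of_real \<kappa>) * F y)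
       = of_real (2 * pi * (real (partition_count n) - real (partition_count (n - 1)) - \<kappa> * real (partition_count n)))"
    proof (rule integral_unique)
      have "((\<lambda>y. F y - exp (log_gf (Complex a y)) * exp (of_nat (n - 1) * Complex a y) - of_real \<kappa> * F y) has_integral
        of_real (2 * pi * real (partition_count n)) - of_real (2 * pi * real (partition_count (n - 1)))
          - of_real \<kappa> * of_real (2 * pi * real (partition_count n))) {-pi..pi}"
        unfolding F_def
        by (intro has_integral_diff has_integral_mult_right partition_count_has_integral a)
      moreover have "exp (log_gf (Complex a y)) * exp (of_nat (n - 1) * Complex a y) = exp (- Complex a y) * F y" for y
      proof -
        have "exp (of_nat (n - 1) * Complex a y) = exp (- Complex a y) * exp (of_nat n * Complex a y)"
          unfolding exp_add[symmetric] using n0 by (simp add: of_nat_diff algebra_simps)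
        then show ?thesis by (simp add: F_def)
      qed
      ultimately show "((\<lambda>y. (1 - exp (- Complex a y) - of_real \<kappa>) * F y) has_integral
        of_real (2 * pi * (real (partition_count n) - real (partition_count (n - 1)) - \<kappa> * real (partition_count n)))) {-pi..pi}"
        by (simp add: algebra_simps)
    qed
    \<comment> \<open>\<open>p n\<close> from below: up to the factor \<open>a * cmod V\<close>, the main integral is at least
      \<open>m / 4\<close>, of which \<open>E\<close> and the minor arc cost at most \<open>m / 8\<close> and \<open>m / 16\<close>.\<close>
    have lower_p: "D / 16 \<le> 2 * pi * real (partition_count n)"
    proof -
      have "cmod (integral {-pi..pi} (\<lambda>y. 1 * F y) - of_real a * integral {-1..1} (\<lambda>t. 1 * F (a * t))) \<le> D / (16 * X ^ 3)"
        using minor_arc_split[OF a, of "\<lambda>_. 1" n] minor' unfolding F_def by simp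
      moreover have "D / (16 * X ^ 3) \<le> D / 16"
        using X1 D0 by (intro divide_left_mono) auto
      ultimately have 1: "cmod (integral {-pi..pi} F - of_real a * (V * integral {-1..1} (\<lambda>t. E t * f t))) \<le> D / 16"
        by (simp add: Fa)
      have "C * a * (10 * exp (2 * X) / sqrt X) \<le> m / 8"
        using mult_right_mono[OF Ca, of m] m0 by (simp add: a_def m_def)
      then have "m / 8 \<le> cmod (integral {-1..1} (\<lambda>t. E t * f t))"
        using major(1) lower by (simp add: m_def)
      then have "a * (cmod V * (m / 8)) \<le> a * (cmod V * cmod (integral {-1..1} (\<lambda>t. E t * f t)))"
        using a by (intro mult_left_mono) auto
      then have "D / 8 \<le> cmod (of_real a * (V * integral {-1..1} (\<lambda>t. E t * f t)))"
        using a by (simp add: D_def norm_mult)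
      also have "\<dots> \<le> cmod (integral {-pi..pi} F) + D / 16"
        using 1 norm_triangle_sub[of "of_real a * (V * integral {-1..1} (\<lambda>t. E t * f t))" "integral {-pi..pi} F"]
        by (simp add: norm_minus_commute)
      also have "cmod (integral {-pi..pi} F) = 2 * pi * real (partition_count n)"
        unfolding I0 norm_of_real by simp
      finally show ?thesis by simp
    qed
    \<comment> \<open>The deviation of \<open>1 - p (n - 1) / p n\<close> from \<open>\<kappa>\<close>, before division by \<open>p n\<close>.\<close>
    have upper: "2 * pi * \<bar>real (partition_count n) - real (partition_count (n - 1)) - \<kappa> * real (partition_count n)\<bar> \<le> D * B0 / X ^ 3"
    proof -
      define w where "w = (\<lambda>y. 1 - exp (- Complex a y) - of_real \<kappa>)"
      have wa: "w (a * t) = 1 - exp (- (of_real a * (1 + \<i> * of_real t))) - of_real \<kappa>" for t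
      proof -
        have "Complex a (a * t) = of_real a * (1 + \<i> * of_real t)" by (simp add: complex_eq_iff)
        then show ?thesis by (simp add: w_def)
      qed
      have e: "exp (-a) \<le> 1" "exp (-a) > 0" using a by auto
      have "exp (-a) * a / X \<le> 1 * 1 / 1" using e a X1 by (intro frac_le mult_mono) auto
      moreover have "exp (-a) * a / X \<ge> 0" using a X0 by simp
      ultimately have kap: "\<bar>\<kappa>\<bar> \<le> 2" using e unfolding \<kappa>_def by linarith
      have w5: "cmod (w y) \<le> 5" for y
      proof -
        have "cmod (w y) \<le> cmod (1 - exp (- Complex a y)) + cmod (of_real \<kappa>)" unfolding w_def by (rule norm_triangle_ineq4)
        also have "cmod (1 - exp (- Complex a y)) \<le> cmod 1 + cmod (exp (- Complex a y))" by (rule norm_triangle_ineq4)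
        finally have "cmod (w y) \<le> 1 + exp (-a) + \<bar>\<kappa>\<bar>" by simp
        with e kap show ?thesis by linarith
      qed
      have cw: "continuous_on {-pi..pi} w"
      proof -
        have "Complex a y = of_real a + \<i> * of_real y" for y by (simp add: complex_eq_iff)
        then show ?thesis unfolding w_def by (simp only:) (intro continuous_intros)
      qed
      have "cmod (integral {-pi..pi} (\<lambda>y. w y * F y) - of_real a * integral {-1..1} (\<lambda>t. w (a * t) * F (a * t))) \<le> D / (16 * X ^ 3)"
        using minor_arc_split[OF a cw w5, of n] minor' unfolding F_def by (rule order_trans)
      moreover have "integral {-1..1} (\<lambda>t. w (a * t) * F (a * t)) = V * integral {-1..1} (\<lambda>t. w (a * t) * (E t * f t))"
        by (simp add: Fa mult.left_commute)
      ultimately have 1: "cmod (integral {-pi..pi} (\<lambda>y. w y * F y)) \<le> a * (cmod V * cmod (integral {-1..1} (\<lambda>t. w (a * t) * (E t * f t)))) + D / (16 * X ^ 3)"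
        using a norm_triangle_sub[of "integral {-pi..pi} (\<lambda>y. w y * F y)" "of_real a * integral {-1..1} (\<lambda>t. w (a * t) * F (a * t))"]
        by (simp add: norm_mult)
      have "cmod (integral {-1..1} (\<lambda>t. w (a * t) * (E t * f t)))
         \<le> a * (2 * exp (2 * X) / (X\<^sup>2 * sqrt X)) + (3 * C + 1) * a\<^sup>2 * (50 * exp (2 * X) / (X * sqrt X))"
        unfolding wa using major(2) mult_left_mono[OF drift, of a] a by linarith
      also have "\<dots> = m * (2 * c2 + 50 * (3 * C + 1) * c2\<^sup>2) / X ^ 3"
        using X0 by (simp add: m_def a_def field_simps power2_eq_square power3_eq_cube)
      finally have "a * (cmod V * cmod (integral {-1..1} (\<lambda>t. w (a * t) * (E t * f t))))
         \<le> a * (cmod V * (m * (2 * c2 + 50 * (3 * C + 1) * c2\<^sup>2) / X ^ 3))"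
        using a by (intro mult_left_mono) auto
      also have "\<dots> + D / (16 * X ^ 3) = D * B0 / X ^ 3"
        using X0 by (simp add: D_def B0_def field_simps)
      finally have "cmod (integral {-pi..pi} (\<lambda>y. w y * F y)) \<le> D * B0 / X ^ 3" using 1 by linarith
      then show ?thesis using I1 by (simp add: w_def abs_mult norm_of_real del: of_real_mult of_real_diff)
    qed
    define p p' where "p = real (partition_count n)" and "p' = real (partition_count (n - 1))"
    have p0: "p > 0" using lower_p D0 pi_gt_zero unfolding p_def
      by (smt (verit) divide_pos_pos zero_less_mult_iff)
    have B0: "B0 \<ge> 0" using c2 C(1) by (simp add: B0_def)
    have "D * B0 / X ^ 3 \<le> (16 * (2 * pi * p)) * B0 / X ^ 3"
      using lower_p B0 X0 by (intro divide_right_mono mult_right_mono) (auto simp: p_def)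
    then have "2 * pi * \<bar>p - p' - \<kappa> * p\<bar> \<le> 2 * pi * (p * (16 * B0 / X ^ 3))"
      using upper by (simp add: p_def p'_def mult_ac)
    then have "\<bar>p - p' - \<kappa> * p\<bar> \<le> p * (16 * B0 / X ^ 3)"
      by (rule mult_left_le_imp_le) simp
    also have "\<bar>p - p' - \<kappa> * p\<bar> = p * \<bar>p' / p - (1 - \<kappa>)\<bar>"
    proof -
      have "p - p' - \<kappa> * p = - (p * (p' / p - (1 - \<kappa>)))" using p0 by (simp add: field_simps)
      then show ?thesis using p0 by (simp add: abs_mult)
    qed
    finally have "\<bar>p' / p - (1 - \<kappa>)\<bar> \<le> 16 * B0 / X ^ 3"
      using p0 by (rule mult_left_le_imp_le)
    also have "1 - \<kappa> = exp (- a) * (1 + a / X)" by (simp add: \<kappa>_def algebra_simps)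
    finally show "\<bar>real (partition_count (n - 1)) / real (partition_count n)
        - exp (- (c2 / X)) * (1 + c2 / X / X)\<bar> \<le> 16 * B0 / X ^ 3"
      by (simp add: p_def p'_def a_def)
  qed
  show ?thesis
    by (rule exI[of _ "16 * B0"], rule eventually_mono[OF eventually_compose_filterlim[OF ev X]])
      (auto simp: c2_def)
qed

theorem theorem1:
  shows "(\<forall>n\<ge>1. prob_largest_part_unique n
              = real (partition_count (n - 1)) / real (partition_count n)) \<and>
         (let c = pi / sqrt 6 in
           (\<lambda>n::nat. prob_largest_part_unique n
               - (1 - c / sqrt (real n) + (1 + c\<^sup>2 / 2) / real n))
             \<in> O[sequentially](\<lambda>n. real n powr (-3/2)))"
proof -
  define c where "c = pi / sqrt 6"
  have c: "c > 0" "c\<^sup>2 = pi\<^sup>2 / 6" by (simp_all add: c_def power_divide)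
  define r where "r = (\<lambda>n. real (partition_count (n - 1)) / real (partition_count n))"
  define s where "s = (\<lambda>n. exp (- (c / sqrt (real n))) * (1 + 1 / real n))"
  obtain B where B: "\<forall>\<^sub>F n in sequentially. \<forall>X. X = c * sqrt (real n) \<longrightarrow>
     \<bar>r n - exp (- (c\<^sup>2 / X)) * (1 + c\<^sup>2 / X / X)\<bar> \<le> B / X ^ 3"
    using partition_ratio_estimate unfolding c_def[symmetric] c(2)[symmetric] r_def by blast
  have "(\<lambda>n. r n - s n) \<in> O(\<lambda>n. B / (c * sqrt (real n)) ^ 3)"
  proof (rule bigoI[of _ 1])
    show "\<forall>\<^sub>F n in sequentially. norm (r n - s n) \<le> 1 * norm (B / (c * sqrt (real n)) ^ 3)"
      using B eventually_gt_at_top[of 0]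
    proof eventually_elim
      case (elim n)
      have "c\<^sup>2 / (c * sqrt (real n)) = c / sqrt (real n)"
        "c\<^sup>2 / (c * sqrt (real n)) / (c * sqrt (real n)) = 1 / real n"
        using c(1) elim by (simp_all add: power2_eq_square)
      then have "\<bar>r n - s n\<bar> \<le> B / (c * sqrt (real n)) ^ 3"
        using elim(1) by (simp add: s_def)
      then have "\<bar>r n - s n\<bar> \<le> \<bar>B / (c * sqrt (real n)) ^ 3\<bar>"
        by (rule order_trans[OF _ abs_ge_self])
      then show ?case by (simp only: real_norm_def mult_1)
    qed
  qed
  also have "(\<lambda>n::nat. B / (c * sqrt (real n)) ^ 3) \<in> O(\<lambda>n. real n powr (-3/2))"
    using c(1) by real_asymp
  finally have "(\<lambda>n. r n - s n) \<in> O(\<lambda>n. real n powr (-3/2))" .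
  moreover have "(\<lambda>n. s n - (1 - c / sqrt (real n) + (1 + c\<^sup>2 / 2) / real n)) \<in> O(\<lambda>n. real n powr (-3/2))"
    unfolding s_def by (rule ratio_main_term_expansion[OF c(1)])
  ultimately have "(\<lambda>n. (r n - s n) + (s n - (1 - c / sqrt (real n) + (1 + c\<^sup>2 / 2) / real n)))
      \<in> O(\<lambda>n. real n powr (-3/2))"
    by (rule sum_in_bigo(1))
  also have "(\<lambda>n. (r n - s n) + (s n - (1 - c / sqrt (real n) + (1 + c\<^sup>2 / 2) / real n)))
      = (\<lambda>n. r n - (1 - c / sqrt (real n) + (1 + c\<^sup>2 / 2) / real n))"
    by (rule ext) simp
  finally have "(\<lambda>n. r n - (1 - c / sqrt (real n) + (1 + c\<^sup>2 / 2) / real n)) \<in> O(\<lambda>n. real n powr (-3/2))" .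
  also have "?this \<longleftrightarrow> (\<lambda>n. prob_largest_part_unique n - (1 - c / sqrt (real n) + (1 + c\<^sup>2 / 2) / real n))
     \<in> O(\<lambda>n. real n powr (-3/2))"
  proof (rule landau_o.big.in_cong)
    show "\<forall>\<^sub>F n in sequentially. r n - (1 - c / sqrt (real n) + (1 + c\<^sup>2 / 2) / real n)
       = prob_largest_part_unique n - (1 - c / sqrt (real n) + (1 + c\<^sup>2 / 2) / real n)"
      using eventually_ge_at_top[of 1] by eventually_elim (simp add: r_def prob_largest_part_unique_eq)
  qed
  finally show ?thesis
    unfolding Let_def c_def[symmetric] using prob_largest_part_unique_eq by blast
qed

end
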